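(* Let $H_1,H_2$ be complex Hilbert spaces and let $T\in\mathcal{AN}(H_1,H_2)$ with polar decomposition $T=V|T|$. Then there exist $K\in\mathcal K(H_1,H_2)$, $F\in\mathcal F(H_1,H_2)$ and a real number $\alpha\ge 0$ such that $$T=K-F+\alpha V,\qquad K^*F=0=KF^*,\qquad F^*F\le\alpha^2 I.$$
   Context: $\mathcal B(H_1,H_2)$, $\mathcal K(H_1,H_2)$, $\mathcal F(H_1,H_2)$ denote the bounded, compact, and finite rank linear operators from $H_1$ to $H_2$. For self-adjoint $S,T$, $S\le T$ means $T-S$ is positive. $|T|=(T^*T)^{1/2}$; the polar decomposition $T=V|T|$ is the one with $V\in\mathcal B(H_1,H_2)$ the unique partial isometry satisfying $N(V)=N(T)$ (null spaces). An operator $T\in\mathcal B(H_1,H_2)$ is norm attaining if there is a unit vector $x\in H_1$ with $\|Tx\|=\|T\|$; it is absolutely norm attaining, written $T\in\mathcal{AN}(H_1,H_2)$, if the restriction $T|_M:M\to H_2$ is norm attaining for every nonzero closed subspace $M$ of $H_1$. *)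

theory Defs
  imports "HOL-Analysis.Analysis"
begin

section \<open>Complex Hilbert spaces\<close>

text \<open>
  The underlying real inner product is required to be the real part of the complex one, so that
  the norm, the topology and completeness are those of \<^class>\<open>real_inner\<close>.
  The complex inner product is linear in the first argument.
\<close>

class complex_inner = real_inner +
  fixes scaleC :: "complex \<Rightarrow> 'a \<Rightarrow> 'a"
    and cinner :: "'a \<Rightarrow> 'a \<Rightarrow> complex"
  assumes scaleC_add_right: "scaleC a (x + y) = scaleC a x + scaleC a y"
    and scaleC_add_left: "scaleC (a + b) x = scaleC a x + scaleC b x"
    and scaleC_scaleC: "scaleC a (scaleC b x) = scaleC (a * b) x"
    and scaleC_of_real: "scaleC (complex_of_real r) x = scaleR r x"
    and cinner_commute: "cinner x y = cnj (cinner y x)"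
    and cinner_add_left: "cinner (x + y) z = cinner x z + cinner y z"
    and cinner_scaleC_left: "cinner (scaleC a x) y = a * cinner x y"
    and Re_cinner: "Re (cinner x y) = inner x y"

class chilbert_space = complex_inner + complete_space

lemma cinner_self: "cinner x x = complex_of_real ((norm x)\<^sup>2)"
  for x :: "'a::complex_inner"
proof -
  have "Im (cinner x x) = 0"
    using cinner_commute[of x x] by (metis complex_cnj cnj.sel(2) neg_equal_zero)
  then show ?thesis
    by (simp add: complex_eq_iff Re_cinner power2_norm_eq_inner)
qed

instantiation complex :: chilbert_space
begin

definition scaleC_complex :: "complex \<Rightarrow> complex \<Rightarrow> complex"
  where "scaleC_complex a x = a * x"

definition cinner_complex :: "complex \<Rightarrow> complex \<Rightarrow> complex"
  where "cinner_complex x y = x * cnj y"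

instance
  by standard
    (auto simp: scaleC_complex_def cinner_complex_def inner_complex_def algebra_simps
      scaleR_conv_of_real)

end

global_interpretation complex_vector:
  vector_space "scaleC :: complex \<Rightarrow> 'a \<Rightarrow> 'a::complex_inner"
  defines csubspace = complex_vector.subspace
    and cspan = complex_vector.span
proof
  show "scaleC 1 x = x" for x :: 'a
    using scaleC_of_real[of 1 x] by simp
qed (simp_all add: scaleC_add_right scaleC_add_left scaleC_scaleC)


section \<open>Bounded, compact and finite rank operators\<close>

definition bounded_clinear :: "('a::complex_inner \<Rightarrow> 'b::complex_inner) \<Rightarrow> bool"
  where "bounded_clinear T \<longleftrightarrow> Vector_Spaces.linear scaleC scaleC T \<and> bounded_linear T"

definition compact_operator :: "('a::complex_inner \<Rightarrow> 'b::complex_inner) \<Rightarrow> bool"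
  where "compact_operator T \<longleftrightarrow> bounded_clinear T \<and> compact (closure (T ` cball 0 1))"

definition finite_rank :: "('a::complex_inner \<Rightarrow> 'b::complex_inner) \<Rightarrow> bool"
  where "finite_rank T \<longleftrightarrow> bounded_clinear T \<and> (\<exists>B. finite B \<and> range T = cspan B)"


section \<open>Adjoint, positivity, modulus and polar decomposition\<close>

definition cadjoint :: "('a::chilbert_space \<Rightarrow> 'b::chilbert_space) \<Rightarrow> 'b \<Rightarrow> 'a"
  where "cadjoint T = (THE S. \<forall>x y. cinner (T x) y = cinner x (S y))"

lemma cadjoint_eqI:
  fixes T :: "'a::chilbert_space \<Rightarrow> 'b::chilbert_space"
  assumes "\<And>x y. cinner (T x) y = cinner x (S y)"
  shows "cadjoint T = S"
  unfolding cadjoint_def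
proof (rule the_equality)
  fix S' assume *: "\<forall>x y. cinner (T x) y = cinner x (S' y)"
  have "inner x (S' y) = inner x (S y)" for x y
    using * assms by (metis Re_cinner)
  then show "S' = S"
    by (intro ext) (metis vector_eq_ldot)
qed (use assms in auto)

definition self_adjoint :: "('a::chilbert_space \<Rightarrow> 'a) \<Rightarrow> bool"
  where "self_adjoint T \<longleftrightarrow> bounded_clinear T \<and> cadjoint T = T"

text \<open>For self-adjoint operators the values of the quadratic form are real.\<close>

definition positive_operator :: "('a::chilbert_space \<Rightarrow> 'a) \<Rightarrow> bool"
  where "positive_operator T \<longleftrightarrow> self_adjoint T \<and> (\<forall>x. 0 \<le> Re (cinner (T x) x))"

definition operator_le :: "('a::chilbert_space \<Rightarrow> 'a) \<Rightarrow> ('a \<Rightarrow> 'a) \<Rightarrow> bool"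
  where "operator_le S T \<longleftrightarrow>
    self_adjoint S \<and> self_adjoint T \<and> positive_operator (\<lambda>x. T x - S x)"

definition operator_abs :: "('a::chilbert_space \<Rightarrow> 'b::chilbert_space) \<Rightarrow> 'a \<Rightarrow> 'a"
  where "operator_abs T = (THE P. positive_operator P \<and> P \<circ> P = cadjoint T \<circ> T)"

definition null_space :: "('a::complex_inner \<Rightarrow> 'b::complex_inner) \<Rightarrow> 'a set"
  where "null_space T = {x. T x = 0}"

definition partial_isometry :: "('a::chilbert_space \<Rightarrow> 'b::chilbert_space) \<Rightarrow> bool"
  where "partial_isometry V \<longleftrightarrow> bounded_clinear V \<and>
    (\<forall>x. (\<forall>y\<in>null_space V. cinner x y = 0) \<longrightarrow> norm (V x) = norm x)"

definition polar_decomposition ::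
    "('a::chilbert_space \<Rightarrow> 'b::chilbert_space) \<Rightarrow> ('a \<Rightarrow> 'b) \<Rightarrow> bool"
  where "polar_decomposition T V \<longleftrightarrow>
    partial_isometry V \<and> null_space V = null_space T \<and> T = V \<circ> operator_abs T"


section \<open>Absolutely norm attaining operators\<close>

text \<open>The operator norm of the restriction of \<open>T\<close> to \<open>M\<close>, in the form of \<^const>\<open>onorm\<close>.\<close>

definition onorm_on ::
    "'a::real_normed_vector set \<Rightarrow> ('a \<Rightarrow> 'b::real_normed_vector) \<Rightarrow> real"
  where "onorm_on M T = (SUP x\<in>M. norm (T x) / norm x)"

lemma onorm_on_UNIV: "onorm_on UNIV T = onorm T"
  by (simp add: onorm_on_def onorm_def)

definition norm_attaining_on ::
    "'a::real_normed_vector set \<Rightarrow> ('a \<Rightarrow> 'b::real_normed_vector) \<Rightarrow> bool"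
  where "norm_attaining_on M T \<longleftrightarrow> (\<exists>x\<in>M. norm x = 1 \<and> norm (T x) = onorm_on M T)"

definition absolutely_norm_attaining ::
    "('a::chilbert_space \<Rightarrow> 'b::chilbert_space) \<Rightarrow> bool"
  where "absolutely_norm_attaining T \<longleftrightarrow> bounded_clinear T \<and>
    (\<forall>M. csubspace M \<and> closed M \<and> M \<noteq> {0} \<longrightarrow> norm_attaining_on M T)"

end

theory Submission
  imports Defs
begin

text \<open>
  A maximal orthonormal set of eigenvectors of \<open>T\<^sup>*T\<close> is a basis \<open>E\<close>: on the
  orthogonal complement, which is invariant, \<open>T\<close> attains its norm, and a maximizer is a further
  eigenvector. Testing norm attainment on closed spans of suitable orthonormal families shows that
  the numbers \<open>\<lambda>\<^sub>e = \<parallel>T e\<parallel>\<close> can accumulate only at a single \<open>\<alpha>\<close>, and only from above: finitely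
  many exceed \<open>\<alpha> + \<epsilon>\<close> for each \<open>\<epsilon> > 0\<close>, and finitely many lie below \<open>\<alpha>\<close>.
  Now \<open>|T|\<close> is the diagonal operator with entries \<open>\<lambda>\<^sub>e\<close> and \<open>V\<^sup>*V\<close> the one with
  entries \<open>1\<close> or \<open>0\<close> according to \<open>\<lambda>\<^sub>e \<noteq> 0\<close> or \<open>\<lambda>\<^sub>e = 0\<close>. So one takes \<open>K\<close> and
  \<open>F\<close> to be \<open>V\<close> composed with the diagonal operators with entries
  \<open>max (\<lambda>\<^sub>e - \<alpha>) 0\<close> and \<open>max (\<alpha> - \<lambda>\<^sub>e) 0\<close>, whose product vanishes.
\<close>

section \<open>Complex inner products and bounded operators\<close>

lemma cinner_add_right: "cinner x (y + z) = cinner x y + cinner x z"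
  by (metis cinner_add_left cinner_commute complex_cnj_add)

lemma cinner_scaleC_right: "cinner x (scaleC a y) = cnj a * cinner x y"
  by (metis cinner_commute cinner_scaleC_left complex_cnj_mult)

lemma cinner_zero_left [simp]: "cinner 0 x = 0"
  using cinner_add_left[of 0 0 x] by simp

lemma cinner_zero_right [simp]: "cinner x 0 = 0"
  using cinner_add_right[of x 0 0] by simp

lemma cinner_diff_left: "cinner (x - y) z = cinner x z - cinner y z"
  using cinner_add_left[of "x - y" y z] by simp

lemma cinner_diff_right: "cinner x (y - z) = cinner x y - cinner x z"
  using cinner_add_right[of x "y - z" z] by simp

lemma cinner_scaleR_left: "cinner (r *\<^sub>R x) y = complex_of_real r * cinner x y"
  by (metis cinner_scaleC_left scaleC_of_real)

lemma cinner_scaleR_right: "cinner x (r *\<^sub>R y) = complex_of_real r * cinner x y"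
  by (metis cinner_scaleC_right complex_cnj_complex_of_real scaleC_of_real)

lemma cinner_sum_right: "cinner x (sum f A) = (\<Sum>i\<in>A. cinner x (f i))"
  by (induction A rule: infinite_finite_induct) (simp_all add: cinner_add_right)

lemma cinner_eq_0_commute: "cinner x y = 0 \<longleftrightarrow> cinner y x = 0"
  by (metis cinner_commute complex_cnj_zero)

lemma cinner_self_eq_0 [simp]: "cinner x x = 0 \<longleftrightarrow> x = 0"
  by (simp add: cinner_self)

lemma norm_scaleC: "norm (scaleC a x) = cmod a * norm x"
proof -
  have "complex_of_real ((norm (scaleC a x))\<^sup>2) = a * cnj a * complex_of_real ((norm x)\<^sup>2)"
    unfolding cinner_self[symmetric] by (simp add: cinner_scaleC_left cinner_scaleC_right)
  also have "\<dots> = complex_of_real ((cmod a * norm x)\<^sup>2)"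
    by (simp add: complex_norm_square[symmetric] power_mult_distrib)
  finally have "(norm (scaleC a x))\<^sup>2 = (cmod a * norm x)\<^sup>2"
    by (simp only: of_real_eq_iff)
  then show ?thesis
    by (simp add: power2_eq_iff_nonneg)
qed

text \<open>The class only supplies the real Cauchy-Schwarz inequality. Multiplying \<open>x\<close>
  by a unimodular scalar turns \<open>cinner x y\<close> into its modulus, which is then a real
  inner product; the scalar changes no norm.\<close>

lemma norm_cinner_le: "cmod (cinner x y) \<le> norm x * norm y"
proof -
  define z where "z = cinner x y"
  obtain a where a: "cmod a = 1" "a * z = complex_of_real (cmod z)"
  proof (cases "z = 0")
    case True then show ?thesis using that[of 1] by simp
  next
    case False
    have "cnj z / complex_of_real (cmod z) * z = complex_of_real (cmod z)"
      using False complex_norm_square[of z] by (simp add: field_simps power2_eq_square)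
    then show ?thesis
      using that[of "cnj z / complex_of_real (cmod z)"] False by (simp add: norm_divide)
  qed
  have "cmod z = Re (cinner (scaleC a x) y)"
    using a by (simp add: cinner_scaleC_left z_def)
  also have "\<dots> \<le> norm (scaleC a x) * norm y"
    unfolding Re_cinner by (rule norm_cauchy_schwarz)
  finally show ?thesis
    using a by (simp add: norm_scaleC z_def)
qed

section \<open>Bounded complex-linear maps\<close>

lemma bounded_clinearI:
  assumes "\<And>x y. f (x + y) = f x + f y" "\<And>a x. f (scaleC a x) = scaleC a (f x)"
    and "\<And>x. norm (f x) \<le> B * norm x"
  shows "bounded_clinear f"
proof -
  have "Vector_Spaces.linear scaleC scaleC f"
    by unfold_locales (simp_all add: assms scaleC_add_right scaleC_add_left scaleC_scaleC
      scaleC_of_real[of 1, simplified])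
  moreover have "bounded_linear f"
  proof (rule bounded_linear_intro[where K = B])
    show "f (r *\<^sub>R x) = r *\<^sub>R f x" for r x
      by (metis assms(2) scaleC_of_real)
    show "norm (f x) \<le> norm x * B" for x
      using assms(3)[of x] by (simp add: mult.commute)
  qed (rule assms)
  ultimately show ?thesis
    by (simp add: bounded_clinear_def)
qed

context
  fixes f :: "'a::complex_inner \<Rightarrow> 'b::complex_inner"
  assumes f: "bounded_clinear f"
begin

lemma bounded_clinear_linear: "bounded_linear f"
  using f by (simp add: bounded_clinear_def)

lemma bounded_clinear_add: "f (x + y) = f x + f y"
  using bounded_clinear_linear by (simp add: linear_simps)

lemma bounded_clinear_diff: "f (x - y) = f x - f y"
  using bounded_clinear_linear by (simp add: linear_simps)

lemma bounded_clinear_zero: "f 0 = 0"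
  using bounded_clinear_linear by (simp add: linear_simps)

lemma bounded_clinear_scaleR: "f (r *\<^sub>R x) = r *\<^sub>R f x"
  using bounded_clinear_linear by (simp add: linear_simps)

lemma bounded_clinear_sum: "f (sum g A) = (\<Sum>i\<in>A. f (g i))"
  using bounded_clinear_linear by (simp add: bounded_linear.linear linear_sum)

lemma bounded_clinear_scaleC: "f (scaleC a x) = scaleC a (f x)"
proof -
  interpret Vector_Spaces.linear scaleC scaleC f
    using f by (simp add: bounded_clinear_def)
  show ?thesis by (rule scale)
qed

end

lemma bounded_clinear_compose:
  assumes f: "bounded_clinear f" and g: "bounded_clinear g"
  shows "bounded_clinear (f \<circ> g)"
proof -
  obtain A where A: "0 < A" "\<And>x. norm (f x) \<le> norm x * A"
    using bounded_linear.pos_bounded[OF bounded_clinear_linear[OF f]] by blast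
  obtain B where B: "0 < B" "\<And>x. norm (g x) \<le> norm x * B"
    using bounded_linear.pos_bounded[OF bounded_clinear_linear[OF g]] by blast
  show ?thesis
  proof (rule bounded_clinearI[where B = "A * B"])
    fix x
    have "norm ((f \<circ> g) x) \<le> norm (g x) * A"
      using A by simp
    also have "\<dots> \<le> norm x * B * A"
      using A B by (intro mult_right_mono) auto
    finally show "norm ((f \<circ> g) x) \<le> A * B * norm x"
      by (simp add: mult_ac)
  qed (simp_all add: bounded_clinear_add bounded_clinear_scaleC f g)
qed

lemma bounded_linear_cinner_left: "bounded_linear (\<lambda>x. cinner x y)"
  by (rule bounded_linear_intro[where K = "norm y"])
    (simp_all add: cinner_add_left cinner_scaleR_left norm_cinner_le scaleR_conv_of_real)

lemma bounded_linear_scaleC: "bounded_linear (scaleC a :: 'a \<Rightarrow> 'a::complex_inner)"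
proof (rule bounded_linear_intro[where K = "cmod a"])
  show "scaleC a (r *\<^sub>R x) = r *\<^sub>R scaleC a x" for r and x :: 'a
    unfolding scaleC_of_real[symmetric] scaleC_scaleC by (simp add: mult.commute)
qed (simp_all add: scaleC_add_right norm_scaleC mult.commute)

section \<open>Orthonormal sets\<close>

definition orthonormal :: "'a::complex_inner set \<Rightarrow> bool"
  where "orthonormal E \<longleftrightarrow> (\<forall>e\<in>E. norm e = 1) \<and> (\<forall>e\<in>E. \<forall>f\<in>E. e \<noteq> f \<longrightarrow> cinner e f = 0)"

definition orthonormal_basis :: "'a::complex_inner set \<Rightarrow> bool"
  where "orthonormal_basis E \<longleftrightarrow> orthonormal E \<and> (\<forall>x. (\<forall>e\<in>E. cinner x e = 0) \<longrightarrow> x = 0)"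

lemma orthonormal_cinner:
  assumes "orthonormal E" "e \<in> E" "f \<in> E"
  shows "cinner e f = (if e = f then 1 else 0)"
  using assms by (auto simp: orthonormal_def cinner_self)

text \<open>By Pythagoras the squared distance between two nested partial sums is the difference of
  their sums of squared norms. Beyond a finite set whose sum of squares is close to the supremum
  \<open>s\<close>, this is small, so the net of partial sums is Cauchy and completeness gives a
  limit.\<close>

lemma summable_on_orthogonal:
  fixes f :: "'i \<Rightarrow> 'a::{real_inner, complete_space}"
  assumes orth: "pairwise (\<lambda>i j. orthogonal (f i) (f j)) A"
    and bound: "\<And>F. finite F \<Longrightarrow> F \<subseteq> A \<Longrightarrow> (\<Sum>i\<in>F. (norm (f i))\<^sup>2) \<le> B"
  shows "f summable_on A"
proof -
  define q where "q F = (\<Sum>i\<in>F. (norm (f i))\<^sup>2)" for F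
  define s where "s = (SUP F\<in>{F. finite F \<and> F \<subseteq> A}. q F)"
  have bdd: "bdd_above (q ` {F. finite F \<and> F \<subseteq> A})"
    using bound by (auto simp: q_def bdd_above_def)
  have "\<exists>P. eventually P (finite_subsets_at_top A) \<and>
          (\<forall>F F'. P F \<and> P F' \<longrightarrow> dist (sum f F) (sum f F') < e)" if "e > 0" for e
  proof -
    \<comment> \<open>Two partial sums are compared through the one over \<open>F0\<close>, which
      costs half of \<open>e\<close> each.\<close>
    define d where "d = e / 2"
    then have d: "d > 0" using that by simp
    have "\<exists>F\<in>{F. finite F \<and> F \<subseteq> A}. s - d\<^sup>2 < q F"
      using d bdd unfolding s_def by (subst less_cSUP_iff[symmetric]) auto
    then obtain F0 where F0: "finite F0" "F0 \<subseteq> A" "s - d\<^sup>2 < q F0"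
      by auto
    have near: "dist (sum f F) (sum f F0) < d" if F: "F0 \<subseteq> F" "finite F" "F \<subseteq> A" for F
    proof -
      have "(dist (sum f F) (sum f F0))\<^sup>2 = (norm (sum f (F - F0)))\<^sup>2"
        using F by (simp add: dist_norm sum_diff)
      also have "\<dots> = q (F - F0)"
        unfolding q_def
        by (rule norm_sum_Pythagorean) (use F orth in \<open>auto intro: pairwise_subset\<close>)
      also have "\<dots> = q F - q F0"
        using F unfolding q_def by (simp add: sum_diff)
      also have "q F \<le> s"
        unfolding s_def by (rule cSUP_upper[OF _ bdd]) (use F in auto)
      finally have "(dist (sum f F) (sum f F0))\<^sup>2 < d\<^sup>2"
        using F0 by simp
      then show ?thesis
        using d power_less_imp_less_base[of _ 2 d] by auto
    qed
    have "eventually (\<lambda>F. F0 \<subseteq> F \<and> finite F \<and> F \<subseteq> A) (finite_subsets_at_top A)"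
      using F0 by (auto simp: eventually_finite_subsets_at_top)
    moreover have "dist (sum f F) (sum f F') < e"
      if "F0 \<subseteq> F \<and> finite F \<and> F \<subseteq> A" "F0 \<subseteq> F' \<and> finite F' \<and> F' \<subseteq> A" for F F'
      using near[of F] near[of F'] that dist_triangle2[of "sum f F" "sum f F'" "sum f F0"]
      unfolding d_def by linarith
    ultimately show ?thesis
      by (intro exI[of _ "\<lambda>F. F0 \<subseteq> F \<and> finite F \<and> F \<subseteq> A"]) auto
  qed
  then have "cauchy_filter (filtermap (sum f) (finite_subsets_at_top A))"
    by (simp add: cauchy_filter_metric_filtermap)
  moreover have "complete (UNIV::'a set)"
    by (meson Cauchy_convergent UNIV_I complete_def convergent_def)
  ultimately obtain L where "(sum f \<longlongrightarrow> L) (finite_subsets_at_top A)"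
    using complete_uniform[where S = UNIV] by (force simp: filterlim_def)
  then show ?thesis
    using summable_on_def has_sum_def by blast
qed

context
  fixes E :: "'a::chilbert_space set"
  assumes E: "orthonormal E"
begin

lemma orthonormal_pairwise_orthogonal:
  "pairwise (\<lambda>e f. orthogonal (scaleC (c e) e) (scaleC (c f) f)) E"
  by (rule pairwiseI)
    (use E in \<open>auto simp: orthogonal_def Re_cinner[symmetric] cinner_scaleC_left
      cinner_scaleC_right orthonormal_cinner\<close>)

lemma orthonormal_norm_sum:
  assumes "finite F" "F \<subseteq> E"
  shows "(norm (\<Sum>e\<in>F. scaleC (c e) e))\<^sup>2 = (\<Sum>e\<in>F. (cmod (c e))\<^sup>2)"
proof -
  have "(norm (\<Sum>e\<in>F. scaleC (c e) e))\<^sup>2 = (\<Sum>e\<in>F. (norm (scaleC (c e) e))\<^sup>2)"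
    by (rule norm_sum_Pythagorean[OF assms(1)])
      (use assms in \<open>auto intro: pairwise_subset[OF orthonormal_pairwise_orthogonal]\<close>)
  also have "\<dots> = (\<Sum>e\<in>F. (cmod (c e))\<^sup>2)"
    using assms E by (intro sum.cong refl) (auto simp: norm_scaleC orthonormal_def)
  finally show ?thesis .
qed

text \<open>Subtracting the partial Fourier sum \<open>s\<close> from \<open>x\<close> leaves a
  vector of squared norm \<open>(norm x)\<^sup>2 - q\<close>, which cannot be negative.\<close>

lemma Bessel_inequality:
  assumes "finite F" "F \<subseteq> E"
  shows "(\<Sum>e\<in>F. (cmod (cinner x e))\<^sup>2) \<le> (norm x)\<^sup>2"
proof -
  define s where "s = (\<Sum>e\<in>F. scaleC (cinner x e) e)"
  define q where "q = (\<Sum>e\<in>F. (cmod (cinner x e))\<^sup>2)"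
  have "cinner x s = (\<Sum>e\<in>F. complex_of_real ((cmod (cinner x e))\<^sup>2))"
    unfolding s_def cinner_sum_right cinner_scaleC_right
    by (simp add: complex_norm_square mult.commute del: of_real_power)
  then have "cinner x s = complex_of_real q"
    by (simp add: q_def)
  then have "inner x s = q"
    unfolding Re_cinner[symmetric] by simp
  moreover have "(norm s)\<^sup>2 = q"
    unfolding s_def q_def by (rule orthonormal_norm_sum[OF assms])
  moreover have "(norm (x - s))\<^sup>2 = (norm x)\<^sup>2 - 2 * inner x s + (norm s)\<^sup>2"
    by (simp add: power2_norm_eq_inner inner_diff_left inner_diff_right inner_commute)
  ultimately have "(norm x)\<^sup>2 - q = (norm (x - s))\<^sup>2"
    by simp
  then show ?thesis
    unfolding q_def by (metis diff_ge_0_iff_ge zero_le_power2)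
qed

lemma orthonormal_summable:
  assumes "\<And>F. finite F \<Longrightarrow> F \<subseteq> E \<Longrightarrow> (\<Sum>e\<in>F. (cmod (c e))\<^sup>2) \<le> B"
  shows "(\<lambda>e. scaleC (c e) e) summable_on E"
proof (rule summable_on_orthogonal[OF orthonormal_pairwise_orthogonal])
  fix F assume F: "finite F" "F \<subseteq> E"
  have "(\<Sum>e\<in>F. (norm (scaleC (c e) e))\<^sup>2) = (\<Sum>e\<in>F. (cmod (c e))\<^sup>2)"
    using F E by (intro sum.cong refl) (auto simp: norm_scaleC orthonormal_def)
  then show "(\<Sum>e\<in>F. (norm (scaleC (c e) e))\<^sup>2) \<le> B"
    using assms[OF F] by simp
qed

lemma orthonormal_has_sum_coeff:
  assumes "((\<lambda>e. scaleC (c e) e) has_sum s) E" "f \<in> E"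
  shows "cinner s f = c f"
proof -
  have "((\<lambda>e. cinner (scaleC (c e) e) f) has_sum cinner s f) E"
    by (rule has_sum_bounded_linear[OF bounded_linear_cinner_left assms(1)])
  moreover have "((\<lambda>e. cinner (scaleC (c e) e) f) has_sum c f) {f}"
    using orthonormal_cinner[OF E assms(2,2)] by (simp add: has_sum_finiteI cinner_scaleC_left)
  then have "((\<lambda>e. cinner (scaleC (c e) e) f) has_sum c f) E"
    by (rule has_sum_cong_neutral[THEN iffD1, rotated -1])
      (use assms in \<open>auto simp: cinner_scaleC_left orthonormal_cinner[OF E]\<close>)
  ultimately show ?thesis
    by (rule has_sum_unique)
qed

end

section \<open>Diagonal operators\<close>

text \<open>For orthonormal \<open>E\<close> and bounded \<open>d\<close> the series converges by
  Bessel. With all entries 1 the operator is the orthogonal projection onto the closed span of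
  \<open>E\<close>, and it is used as such below.\<close>

definition diag :: "'a::chilbert_space set \<Rightarrow> ('a \<Rightarrow> real) \<Rightarrow> 'a \<Rightarrow> 'a"
  where "diag E d x = infsum (\<lambda>e. scaleC (complex_of_real (d e) * cinner x e) e) E"

context
  fixes E :: "'a::chilbert_space set" and d :: "'a \<Rightarrow> real" and B :: real
  assumes E: "orthonormal E" and d: "\<And>e. e \<in> E \<Longrightarrow> \<bar>d e\<bar> \<le> B"
begin

lemma diag_square_sum_le:
  assumes "finite F" "F \<subseteq> E"
  shows "(\<Sum>e\<in>F. (cmod (complex_of_real (d e) * cinner x e))\<^sup>2) \<le> B\<^sup>2 * (norm x)\<^sup>2"
proof -
  have "(\<Sum>e\<in>F. (cmod (complex_of_real (d e) * cinner x e))\<^sup>2)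
      \<le> (\<Sum>e\<in>F. B\<^sup>2 * (cmod (cinner x e))\<^sup>2)"
  proof (rule sum_mono)
    fix e assume "e \<in> F"
    then have "\<bar>d e\<bar> \<le> B" using d assms by auto
    then have "\<bar>d e\<bar>\<^sup>2 \<le> B\<^sup>2" by (intro power_mono) auto
    then show "(cmod (complex_of_real (d e) * cinner x e))\<^sup>2 \<le> B\<^sup>2 * (cmod (cinner x e))\<^sup>2"
      by (simp add: norm_mult power_mult_distrib mult_right_mono)
  qed
  also have "\<dots> \<le> B\<^sup>2 * (norm x)\<^sup>2"
    unfolding sum_distrib_left[symmetric]
    by (intro mult_left_mono Bessel_inequality[OF E] assms) auto
  finally show ?thesis .
qed

lemma diag_has_sum:
  "((\<lambda>e. scaleC (complex_of_real (d e) * cinner x e) e) has_sum diag E d x) E"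
  unfolding diag_def
  by (intro has_sum_infsum orthonormal_summable[OF E, where B = "B\<^sup>2 * (norm x)\<^sup>2"]
    diag_square_sum_le)

lemma diag_coeff: "e \<in> E \<Longrightarrow> cinner (diag E d x) e = complex_of_real (d e) * cinner x e"
  by (rule orthonormal_has_sum_coeff[OF E diag_has_sum])

lemma diag_cinner_has_sum:
  "((\<lambda>e. complex_of_real (d e) * cinner x e * cinner e y) has_sum cinner (diag E d x) y) E"
  using has_sum_bounded_linear[OF bounded_linear_cinner_left diag_has_sum]
  by (simp add: cinner_scaleC_left)

lemma norm_diag_le:
  assumes "0 \<le> B"
  shows "norm (diag E d x) \<le> B * norm x"
proof (rule tendsto_upperbound)
  show "((\<lambda>F. norm (\<Sum>e\<in>F. scaleC (complex_of_real (d e) * cinner x e) e))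
      \<longlongrightarrow> norm (diag E d x)) (finite_subsets_at_top E)"
    using diag_has_sum[of x] unfolding has_sum_def by (rule tendsto_norm)
  have "norm (\<Sum>e\<in>F. scaleC (complex_of_real (d e) * cinner x e) e) \<le> B * norm x"
    if "finite F" "F \<subseteq> E" for F
  proof (rule power2_le_imp_le)
    show "(norm (\<Sum>e\<in>F. scaleC (complex_of_real (d e) * cinner x e) e))\<^sup>2 \<le> (B * norm x)\<^sup>2"
      using diag_square_sum_le[OF that] orthonormal_norm_sum[OF E that]
      by (simp add: power_mult_distrib)
  qed (use assms in simp)
  then show "\<forall>\<^sub>F F in finite_subsets_at_top E.
      norm (\<Sum>e\<in>F. scaleC (complex_of_real (d e) * cinner x e) e) \<le> B * norm x"
    by (intro eventually_finite_subsets_at_top_weakI) auto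
qed (rule finite_subsets_at_top_neq_bot)

lemma diag_add: "diag E d (x + y) = diag E d x + diag E d y"
  using has_sum_add[OF diag_has_sum[of x] diag_has_sum[of y]] diag_has_sum[of "x + y"]
  by (intro has_sum_unique)
    (auto simp: cinner_add_left distrib_left scaleC_add_left)

lemma diag_scaleC: "diag E d (scaleC a x) = scaleC a (diag E d x)"
  using has_sum_bounded_linear[OF bounded_linear_scaleC[of a] diag_has_sum[of x]]
    diag_has_sum[of "scaleC a x"]
  by (intro has_sum_unique)
    (auto simp: cinner_scaleC_left scaleC_scaleC mult_ac)

lemma bounded_clinear_diag: "bounded_clinear (diag E d)"
\<comment> \<open>The bound on \<open>d\<close> forces \<open>B\<close> to be nonnegative only if
  \<open>E\<close> has an element.\<close>
proof (cases "E = {}")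
  case True
  then have "diag E d = (\<lambda>x. 0)" by (auto simp: diag_def)
  then show ?thesis by (intro bounded_clinearI[where B = 0]) auto
next
  case False
  then have "0 \<le> B" using d by force
  then show ?thesis
    by (intro bounded_clinearI[where B = B] diag_add diag_scaleC norm_diag_le)
qed

lemma cinner_diag_commute: "cinner (diag E d x) y = cinner x (diag E d y)"
proof -
  have "cnj (complex_of_real (d e) * cinner y e * cinner e x)
      = complex_of_real (d e) * cinner x e * cinner e y" for e
    by (metis (no_types, lifting) cinner_commute complex_cnj_complex_of_real complex_cnj_mult
      mult.assoc mult.commute)
  moreover have "((\<lambda>e. cnj (complex_of_real (d e) * cinner y e * cinner e x))
      has_sum cnj (cinner (diag E d y) x)) E"
    using diag_cinner_has_sum by (simp only: has_sum_cnj_iff)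
  ultimately have "((\<lambda>e. complex_of_real (d e) * cinner x e * cinner e y)
      has_sum cinner x (diag E d y)) E"
    by (simp only: cinner_commute[of x "diag E d y", symmetric])
  with diag_cinner_has_sum show ?thesis
    by (rule has_sum_unique)
qed

lemma self_adjoint_diag: "self_adjoint (diag E d)"
  unfolding self_adjoint_def
  by (intro conjI bounded_clinear_diag cadjoint_eqI cinner_diag_commute)

lemma positive_operator_diag:
  assumes "\<And>e. e \<in> E \<Longrightarrow> 0 \<le> d e"
  shows "positive_operator (diag E d)"
  unfolding positive_operator_def
proof (intro conjI allI self_adjoint_diag)
  fix x
  have "((\<lambda>e. Re (complex_of_real (d e) * cinner x e * cinner e x))
      has_sum Re (cinner (diag E d x) x)) E"
    by (rule has_sum_Re[OF diag_cinner_has_sum])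
  moreover have "0 \<le> Re (complex_of_real (d e) * cinner x e * cinner e x)" if "e \<in> E" for e
  proof -
    have "cinner x e * cinner e x = complex_of_real ((cmod (cinner x e))\<^sup>2)"
      using cinner_commute[of e x] by (simp add: complex_norm_square del: of_real_power)
    then show ?thesis
      using assms[OF that] by (simp add: mult.assoc)
  qed
  ultimately show "0 \<le> Re (cinner (diag E d x) x)"
    by (rule has_sum_nonneg)
qed

end

section \<open>Operators on a space with an orthonormal basis\<close>

context
  fixes E :: "'a::chilbert_space set"
  assumes E: "orthonormal_basis E"
begin

lemma orthonormal_basis_orthonormal: "orthonormal E"
  using E by (simp add: orthonormal_basis_def)

lemma orthonormal_basis_eqI:
  assumes "\<And>e. e \<in> E \<Longrightarrow> cinner x e = cinner y e"
  shows "x = y"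
proof -
  have "\<forall>e\<in>E. cinner (x - y) e = 0"
    using assms by (simp add: cinner_diff_left)
  then have "x - y = 0"
    using E unfolding orthonormal_basis_def by blast
  then show ?thesis by simp
qed

lemma diag_one: "diag E (\<lambda>_. 1) x = x"
  by (rule orthonormal_basis_eqI)
    (simp add: diag_coeff[OF orthonormal_basis_orthonormal, where B = 1])

lemma orthonormal_basis_has_sum: "((\<lambda>e. scaleC (cinner x e) e) has_sum x) E"
  using diag_has_sum[OF orthonormal_basis_orthonormal, where d = "\<lambda>_. 1" and B = 1 and x = x]
  by (simp add: diag_one)

lemma bounded_clinear_has_sum:
  assumes "bounded_clinear S"
  shows "((\<lambda>e. scaleC (cinner x e) (S e)) has_sum S x) E"
  using has_sum_bounded_linear[OF bounded_clinear_linear[OF assms] orthonormal_basis_has_sum]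
  by (simp add: bounded_clinear_scaleC[OF assms])

lemma bounded_clinear_eqI:
  assumes "bounded_clinear R" "bounded_clinear S" "\<And>e. e \<in> E \<Longrightarrow> R e = S e"
  shows "R = S"
proof
  fix x
  have "((\<lambda>e. scaleC (cinner x e) (S e)) has_sum R x) E"
    using bounded_clinear_has_sum[OF assms(1)] assms(3)
    by (simp cong: has_sum_cong)
  then show "R x = S x"
    using bounded_clinear_has_sum[OF assms(2)] by (rule has_sum_unique)
qed

text \<open>The basis replaces the Riesz representation theorem: the adjoint at \<open>y\<close>
  must have the Fourier coefficients \<open>cinner y (V e)\<close>, so it is defined by that
  series.\<close>

lemma adjoint_exists:
  fixes V :: "'a \<Rightarrow> 'b::chilbert_space"
  assumes V: "bounded_clinear V"
  shows "\<exists>W. bounded_clinear W \<and> (\<forall>x y. cinner (V x) y = cinner x (W y))"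
proof -
  note on = orthonormal_basis_orthonormal
  obtain B where B: "0 < B" "\<And>x. norm (V x) \<le> norm x * B"
    using bounded_linear.pos_bounded[OF bounded_clinear_linear[OF V]] by blast
  define W where "W y = infsum (\<lambda>e. scaleC (cinner y (V e)) e) E" for y
  have W_sum: "((\<lambda>e. scaleC (cinner y (V e)) e) has_sum W y) E" for y
    unfolding W_def
  proof (intro has_sum_infsum orthonormal_summable[OF on, where B = "(B * norm y)\<^sup>2"])
    fix F assume F: "finite F" "F \<subseteq> E"
    \<comment> \<open>Pairing \<open>y\<close> with the image of the partial sum \<open>z\<close>
      gives \<open>(norm z)\<^sup>2 \<le> B * norm y * norm z\<close>. Cancelling one factor bounds
      all partial sums of squares at once.\<close>
    define z where "z = (\<Sum>e\<in>F. scaleC (cinner y (V e)) e)"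
    define q where "q = (\<Sum>e\<in>F. (cmod (cinner y (V e)))\<^sup>2)"
    have z: "(norm z)\<^sup>2 = q"
      unfolding z_def q_def by (rule orthonormal_norm_sum[OF on F])
    have "cinner y (V z) = (\<Sum>e\<in>F. complex_of_real ((cmod (cinner y (V e)))\<^sup>2))"
      unfolding z_def bounded_clinear_sum[OF V] bounded_clinear_scaleC[OF V]
        cinner_sum_right cinner_scaleC_right
      by (simp add: complex_norm_square mult.commute del: of_real_power)
    then have "cinner y (V z) = complex_of_real q"
      by (simp add: q_def)
    then have "q \<le> norm y * norm (V z)"
      using norm_cinner_le[of y "V z"] by simp
    also have "\<dots> \<le> norm y * (norm z * B)"
      by (intro mult_left_mono B) auto
    finally have "norm z * norm z \<le> (B * norm y) * norm z"
      using z by (simp add: power2_eq_square mult_ac)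
    then have "norm z \<le> B * norm y"
      using B by (cases "norm z = 0") auto
    then show "q \<le> (B * norm y)\<^sup>2"
      unfolding z[symmetric] by (intro power_mono) auto
  qed
  have W_coeff: "cinner (W y) e = cinner y (V e)" if "e \<in> E" for y e
    by (rule orthonormal_has_sum_coeff[OF on W_sum that])
  have adj: "cinner (V x) y = cinner x (W y)" for x y
  proof (rule has_sum_unique)
    show "((\<lambda>e. cinner x e * cinner (V e) y) has_sum cinner (V x) y) E"
      using has_sum_bounded_linear[OF bounded_linear_cinner_left bounded_clinear_has_sum[OF V]]
      by (simp add: cinner_scaleC_left)
    have "((\<lambda>e. cinner x e * cinner e (W y)) has_sum cinner x (W y)) E"
      using has_sum_bounded_linear[OF bounded_linear_cinner_left orthonormal_basis_has_sum]
      by (simp add: cinner_scaleC_left)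
    moreover have "cinner e (W y) = cinner (V e) y" if "e \<in> E" for e
      using W_coeff[OF that, of y] by (metis cinner_commute)
    ultimately show "((\<lambda>e. cinner x e * cinner (V e) y) has_sum cinner x (W y)) E"
      by (simp cong: has_sum_cong)
  qed
  have "bounded_clinear W"
  proof (rule bounded_clinearI[where B = B])
    show "W (x + y) = W x + W y" for x y
      by (rule orthonormal_basis_eqI) (simp add: cinner_add_left W_coeff)
    show "W (scaleC a x) = scaleC a (W x)" for a x
      by (rule orthonormal_basis_eqI) (simp add: cinner_scaleC_left W_coeff)
    fix y
    have "norm (W y) * norm (W y) = cmod (cinner (V (W y)) y)"
      unfolding adj cinner_self by (simp add: power2_eq_square norm_mult)
    also have "\<dots> \<le> norm (V (W y)) * norm y"
      by (rule norm_cinner_le)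
    also have "\<dots> \<le> norm (W y) * B * norm y"
      by (intro mult_right_mono B) auto
    finally have "norm (W y) * norm (W y) \<le> (B * norm y) * norm (W y)"
      by (simp add: mult_ac)
    then show "norm (W y) \<le> B * norm y"
      using B by (cases "norm (W y) = 0") auto
  qed
  with adj show ?thesis by auto
qed

lemma diag_basis:
  assumes "\<And>e. e \<in> E \<Longrightarrow> \<bar>d e\<bar> \<le> B" "e \<in> E"
  shows "diag E d e = d e *\<^sub>R e"
  by (rule orthonormal_basis_eqI)
    (use assms in \<open>auto simp: diag_coeff[OF orthonormal_basis_orthonormal assms(1)]
      cinner_scaleR_left orthonormal_cinner[OF orthonormal_basis_orthonormal]\<close>)

lemma diag_diag:
  assumes "\<And>e. e \<in> E \<Longrightarrow> \<bar>c e\<bar> \<le> B" "\<And>e. e \<in> E \<Longrightarrow> \<bar>d e\<bar> \<le> C"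
  shows "diag E c (diag E d x) = diag E (\<lambda>e. c e * d e) x"
proof (rule orthonormal_basis_eqI)
  fix e assume e: "e \<in> E"
  have "\<bar>c e * d e\<bar> \<le> B * C" if "e \<in> E" for e
    using assms[OF that] by (auto simp: abs_mult intro!: mult_mono)
  then show "cinner (diag E c (diag E d x)) e = cinner (diag E (\<lambda>e. c e * d e) x) e"
    using diag_coeff[OF orthonormal_basis_orthonormal assms(1) e]
      diag_coeff[OF orthonormal_basis_orthonormal assms(2) e]
      diag_coeff[OF orthonormal_basis_orthonormal, of "\<lambda>e. c e * d e" "B * C" e] e
    by simp
qed

text \<open>Since \<open>operator_abs\<close> is a definite description, uniqueness of the positive
  square root has to be shown as well. It is checked on basis vectors: a positive \<open>P\<close>
  whose square has the eigenvalue \<open>(l e)\<^sup>2\<close> at \<open>e\<close> has the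
  eigenvalue \<open>l e\<close> there.\<close>

lemma operator_abs_eq_diag:
  assumes l: "\<And>e. e \<in> E \<Longrightarrow> 0 \<le> l e" "\<And>e. e \<in> E \<Longrightarrow> l e \<le> B"
    and T: "cadjoint T \<circ> T = diag E (\<lambda>e. (l e)\<^sup>2)"
  shows "operator_abs T = diag E l"
  unfolding operator_abs_def
proof (rule the_equality)
  note on = orthonormal_basis_orthonormal
  have l': "\<bar>l e\<bar> \<le> B" if "e \<in> E" for e
    using l[OF that] by simp
  have l2: "\<bar>(l e)\<^sup>2\<bar> \<le> B\<^sup>2" if "e \<in> E" for e
    using l[OF that] by (simp add: power_mono)
  show "positive_operator (diag E l) \<and> diag E l \<circ> diag E l = cadjoint T \<circ> T"
  proof
    show "positive_operator (diag E l)"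
      by (rule positive_operator_diag[OF on l' l(1)])
    show "diag E l \<circ> diag E l = cadjoint T \<circ> T"
      unfolding T by (rule ext) (simp only: comp_apply diag_diag[OF l' l'] power2_eq_square)
  qed
  fix P assume P: "positive_operator P \<and> P \<circ> P = cadjoint T \<circ> T"
  then have bP: "bounded_clinear P" and P_adj: "cadjoint P = P"
    and pos: "\<And>x. 0 \<le> Re (cinner (P x) x)"
    by (simp_all add: positive_operator_def self_adjoint_def)
  \<comment> \<open>The equation \<open>cadjoint P = P\<close> between values of a description gives
    the symmetry of \<open>P\<close> only once some adjoint is known to exist.\<close>
  obtain W where W: "\<forall>x y. cinner (P x) y = cinner x (W y)"
    using adjoint_exists[OF bP] by (elim exE conjE)
  have "cadjoint P = W"
    by (intro cadjoint_eqI W[rule_format])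
  have P_sym: "cinner (P x) y = cinner x (P y)" for x y
    using W[rule_format, of x y] by (simp only: \<open>cadjoint P = W\<close>[symmetric] P_adj)
  show "P = diag E l"
  proof (rule bounded_clinear_eqI[OF bP bounded_clinear_diag[OF on l']])
    fix e assume e: "e \<in> E"
    have PP: "P (P e) = (l e)\<^sup>2 *\<^sub>R e"
    proof -
      have "P (P e) = (P \<circ> P) e" by simp
      also have "\<dots> = diag E (\<lambda>e. (l e)\<^sup>2) e" by (simp only: P[THEN conjunct2] T)
      also have "\<dots> = (l e)\<^sup>2 *\<^sub>R e" by (rule diag_basis[OF l2 e])
      finally show ?thesis .
    qed
    have "P e = l e *\<^sub>R e"
    proof (cases "l e = 0")
      case True
      have "cinner (P e) (P e) = cinner (P (P e)) e"
        by (simp add: P_sym)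
      with PP True show ?thesis by simp
    next
      case False
      \<comment> \<open>Factoring \<open>P\<^sup>2 - (l e)\<^sup>2\<close> shows that
        \<open>u\<close> is an eigenvector for the negative number \<open>- l e\<close> unless it
        vanishes, and positivity of \<open>P\<close> excludes such eigenvectors.\<close>
      define u where "u = P e - l e *\<^sub>R e"
      have "P u = - (l e *\<^sub>R u)"
        unfolding u_def bounded_clinear_diff[OF bP] bounded_clinear_scaleR[OF bP] PP
          scaleR_diff_right scaleR_scaleR power2_eq_square
        by (rule minus_diff_eq[symmetric])
      then have "0 \<le> - (l e * (norm u)\<^sup>2)"
        using pos[of u] by (simp add: Re_cinner power2_norm_eq_inner)
      then have "u = 0"
        using False l(1)[OF e] by (simp add: mult_le_0_iff)
      then show ?thesis by (simp add: u_def)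
    qed
    then show "P e = diag E l e"
      by (simp add: diag_basis[OF l' e])
  qed
qed

end

section \<open>The eigenbasis of an absolutely norm attaining operator\<close>

definition orth_compl :: "'a::complex_inner set \<Rightarrow> 'a set"
  where "orth_compl G = {x. \<forall>g\<in>G. cinner x g = 0}"

lemma csubspace_orth_compl: "csubspace (orth_compl G)"
  unfolding complex_vector.subspace_def orth_compl_def
  by (auto simp: cinner_add_left cinner_scaleC_left)

lemma closed_orth_compl: "closed (orth_compl G)"
proof -
  have "orth_compl G = (\<Inter>g\<in>G. {x. cinner x g = 0})"
    by (auto simp: orth_compl_def)
  moreover have "closed {x. cinner x g = 0}" for g :: 'a
    by (intro closed_Collect_eq continuous_on_const
      linear_continuous_on[OF bounded_linear_cinner_left])
  ultimately show ?thesis by auto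
qed

lemma diff_proj_in_orth_compl:
  assumes "orthonormal E"
  shows "x - diag E (\<lambda>_. 1) x \<in> orth_compl E"
  using diag_coeff[OF assms, of "\<lambda>_. 1" 1] by (simp add: orth_compl_def cinner_diff_left)

text \<open>Continuity lets \<open>T\<close> and the inner product pass through the Fourier series
  of the projection. Inner products of images of vectors in the closed span are thereby reduced to
  those of images of basis vectors.\<close>

lemma bounded_clinear_proj_has_sum:
  assumes "orthonormal E" "bounded_clinear T"
  shows "((\<lambda>e. cinner x e * cinner (T e) y) has_sum cinner (T (diag E (\<lambda>_. 1) x)) y) E"
proof -
  have "((\<lambda>e. scaleC (cinner x e) (T e)) has_sum T (diag E (\<lambda>_. 1) x)) E"
    using has_sum_bounded_linear[OF bounded_clinear_linear[OF assms(2)]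
        diag_has_sum[OF assms(1), where d = "\<lambda>_. 1" and B = 1]]
    by (simp add: bounded_clinear_scaleC[OF assms(2)])
  from has_sum_bounded_linear[OF bounded_linear_cinner_left this] show ?thesis
    by (simp add: cinner_scaleC_left)
qed

text \<open>This trades the supremum of quotients in \<open>onorm_on\<close> for an inequality.
  Boundedness of \<open>T\<close> bounds the quotients, so every one of them is at most the attained
  value; the vector 0 is treated apart.\<close>

lemma absolutely_norm_attainingD:
  assumes "absolutely_norm_attaining T" "csubspace M" "closed M" "M \<noteq> {0}"
  obtains x where "x \<in> M" "norm x = 1" "\<And>y. y \<in> M \<Longrightarrow> norm (T y) \<le> norm (T x) * norm y"
proof -
  have T: "bounded_clinear T"
    using assms(1) by (simp add: absolutely_norm_attaining_def)
  obtain B where B: "0 < B" "\<And>x. norm (T x) \<le> norm x * B"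
    using bounded_linear.pos_bounded[OF bounded_clinear_linear[OF T]] by blast
  obtain x where x: "x \<in> M" "norm x = 1" "norm (T x) = onorm_on M T"
    using assms unfolding absolutely_norm_attaining_def norm_attaining_on_def by blast
  have "norm (T y) / norm y \<le> B" for y
    using B by (cases "y = 0") (auto simp: divide_simps mult.commute)
  then have bdd: "bdd_above ((\<lambda>y. norm (T y) / norm y) ` M)"
    by (auto simp: bdd_above_def)
  have "norm (T y) \<le> norm (T x) * norm y" if "y \<in> M" for y
  proof (cases "y = 0")
    case True
    then show ?thesis by (simp add: bounded_clinear_zero[OF T])
  next
    case False
    have "norm (T y) / norm y \<le> norm (T x)"
      unfolding x onorm_on_def by (rule cSUP_upper[OF that bdd])
    then show ?thesis using False by (simp add: divide_simps)
  qed
  with x show ?thesis using that by blast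
qed

section \<open>First variation of the norm at a maximizer\<close>

lemma power2_norm_add_scaleR:
  "(norm (p + t *\<^sub>R r))\<^sup>2 = (norm p)\<^sup>2 + 2 * t * inner p r + t\<^sup>2 * (norm r)\<^sup>2"
  for p r :: "'a::real_inner"
  unfolding power2_norm_eq_inner
  by (simp add: inner_add_left inner_add_right inner_commute power2_eq_square algebra_simps)

lemma Im_cinner: "Im (cinner u v) = inner u (scaleC \<i> v)"
  unfolding Re_cinner[symmetric] by (simp add: cinner_scaleC_right)

text \<open>The quadratic \<open>c\<^sup>2 * (norm (x + t v))\<^sup>2 - (norm (T (x + t
  v)))\<^sup>2\<close> in the real variable \<open>t\<close> is nonnegative and vanishes at 0, so
  its linear coefficient is 0. The direction \<open>y\<close> yields the real part of the claim, and
  the direction \<i> times \<open>y\<close> the imaginary part.\<close>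

lemma norm_maximizer_cinner:
  assumes T: "bounded_clinear T" and M: "csubspace M" and x: "x \<in> M" "norm x = 1"
    and max: "\<And>y. y \<in> M \<Longrightarrow> norm (T y) \<le> norm (T x) * norm y" and y: "y \<in> M"
  shows "cinner (T x) (T y) = complex_of_real ((norm (T x))\<^sup>2) * cinner x y"
proof -
  define c where "c = norm (T x)"
  have sub: "u + scaleC a v \<in> M" "scaleC a v \<in> M" if "u \<in> M" "v \<in> M" for a u v
    using M that by (simp_all add: complex_vector.subspace_def)
  have max2: "(norm (T u))\<^sup>2 \<le> c\<^sup>2 * (norm u)\<^sup>2" if "u \<in> M" for u
    using power_mono[OF max[OF that], of 2] by (simp add: c_def power_mult_distrib)
  have real: "inner (T x) (T v) = c\<^sup>2 * inner x v" if v: "v \<in> M" for v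
  proof (rule ccontr)
    assume "inner (T x) (T v) \<noteq> c\<^sup>2 * inner x v"
    define a where "a = c\<^sup>2 * inner x v - inner (T x) (T v)"
    define q where "q = c\<^sup>2 * (norm v)\<^sup>2 - (norm (T v))\<^sup>2"
    have a: "a \<noteq> 0" and q: "q \<ge> 0"
      using \<open>inner (T x) (T v) \<noteq> _\<close> max2[OF v] by (auto simp: a_def q_def)
    \<comment> \<open>Here \<open>2 * a\<close> is the linear and \<open>q\<close> the quadratic
      coefficient. This \<open>t\<close> makes the quadratic negative, and the summand 1 keeps the
      denominator positive when \<open>q\<close> is 0.\<close>
    define t where "t = - a / (q + 1)"
    have "x + t *\<^sub>R v \<in> M"
      using sub(1)[OF x(1) v, of "complex_of_real t"] by (simp add: scaleC_of_real)
    from max2[OF this] have "(norm (T x + t *\<^sub>R T v))\<^sup>2 \<le> c\<^sup>2 * (norm (x + t *\<^sub>R v))\<^sup>2"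
      by (simp add: bounded_clinear_add[OF T] bounded_clinear_scaleR[OF T])
    then have "0 \<le> 2 * t * a + t\<^sup>2 * q"
      using x(2) unfolding a_def q_def c_def power2_norm_add_scaleR by (simp add: algebra_simps)
    also have "2 * t * a + t\<^sup>2 * q = - (a\<^sup>2 * (q + 2) / (q + 1)\<^sup>2)"
      using q unfolding t_def by (simp add: divide_simps power2_eq_square) algebra
    also have "\<dots> < 0"
      using a q by simp
    finally show False by simp
  qed
  have "Im (cinner (T x) (T y)) = c\<^sup>2 * Im (cinner x y)"
    unfolding Im_cinner using real[OF sub(2)[OF y y, of \<i>]] by (simp add: bounded_clinear_scaleC[OF T])
  moreover have "Re (cinner (T x) (T y)) = c\<^sup>2 * Re (cinner x y)"
    using real[OF y] by (simp add: Re_cinner)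
  ultimately show ?thesis
    by (simp add: complex_eq_iff c_def)
qed

context
  fixes T :: "'a::chilbert_space \<Rightarrow> 'b::chilbert_space"
  assumes AN: "absolutely_norm_attaining T"
begin

lemma absolutely_norm_attaining_bounded_clinear: "bounded_clinear T"
  using AN by (simp add: absolutely_norm_attaining_def)

text \<open>
  The norm of \<open>T\<close> on the closed span of \<open>G\<close> is attained at a vector with some nonzero
  coefficient along \<open>g\<close>, and comparing \<open>\<langle>T x, T g\<rangle>\<close> in two ways shows that it
  is attained at \<open>g\<close> too. The closed span is taken as a double orthogonal complement.
\<close>

lemma orthogonal_images_norm_attains_max:
  assumes G: "orthonormal G" "G \<noteq> {}"
    and T_orth: "\<And>g h. g \<in> G \<Longrightarrow> h \<in> G \<Longrightarrow> g \<noteq> h \<Longrightarrow> cinner (T g) (T h) = 0"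
  shows "\<exists>g\<in>G. \<forall>h\<in>G. norm (T h) \<le> norm (T g)"
proof -
  note T = absolutely_norm_attaining_bounded_clinear
  define M where "M = orth_compl (orth_compl G)"
  have M: "csubspace M" "closed M"
    by (simp_all add: M_def csubspace_orth_compl closed_orth_compl)
  have GM: "G \<subseteq> M"
    unfolding M_def orth_compl_def using cinner_eq_0_commute by auto
  have "M \<noteq> {0}"
    using G GM unfolding orthonormal_def by force
  then obtain x where x: "x \<in> M" "norm x = 1"
    and max: "\<And>y. y \<in> M \<Longrightarrow> norm (T y) \<le> norm (T x) * norm y"
    using absolutely_norm_attainingD[OF AN M] by blast
  have Mzero: "y = 0" if "y \<in> M" "y \<in> orth_compl G" for y
    using that unfolding M_def orth_compl_def by force
  \<comment> \<open>The maximizer equals its Fourier series over \<open>G\<close>: the difference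
    from its projection lies both in \<open>M\<close> and in the orthogonal complement of
    \<open>G\<close>, and these meet only in 0.\<close>
  have "diag G (\<lambda>_. 1) x \<in> M"
  proof -
    have "cinner (diag G (\<lambda>_. 1) x) y = 0" if "y \<in> orth_compl G" for y
    proof (rule has_sum_unique)
      show "((\<lambda>e. complex_of_real 1 * cinner x e * cinner e y)
          has_sum cinner (diag G (\<lambda>_. 1) x) y) G"
        by (rule diag_cinner_has_sum[OF G(1), where B = 1]) simp
      show "((\<lambda>e. complex_of_real 1 * cinner x e * cinner e y) has_sum 0) G"
        using that by (intro has_sum_0) (simp add: orth_compl_def cinner_eq_0_commute)
    qed
    then show ?thesis by (simp add: M_def orth_compl_def)
  qed
  then have "x - diag G (\<lambda>_. 1) x \<in> M"
    using M(1) x(1) complex_vector.subspace_diff by blast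
  then have xproj: "diag G (\<lambda>_. 1) x = x"
    using Mzero[OF _ diff_proj_in_orth_compl[OF G(1), of x]] by simp
  obtain g where g: "g \<in> G" "cinner x g \<noteq> 0"
    using Mzero[OF x(1)] x(2) unfolding orth_compl_def by fastforce
  have "cinner (T x) (T g) = cinner x g * cinner (T g) (T g)"
  proof (rule has_sum_unique)
    show "((\<lambda>e. cinner x e * cinner (T e) (T g)) has_sum cinner (T x) (T g)) G"
      using bounded_clinear_proj_has_sum[OF G(1) T, of x "T g"] by (simp add: xproj)
    have "((\<lambda>e. cinner x e * cinner (T e) (T g)) has_sum cinner x g * cinner (T g) (T g)) {g}"
      by (simp add: has_sum_finiteI)
    then show "((\<lambda>e. cinner x e * cinner (T e) (T g))
        has_sum cinner x g * cinner (T g) (T g)) G"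
      by (rule has_sum_cong_neutral[THEN iffD1, rotated -1]) (use g T_orth in auto)
  qed
  moreover have "cinner (T x) (T g) = complex_of_real ((norm (T x))\<^sup>2) * cinner x g"
    using norm_maximizer_cinner[OF T M(1) x max] g GM by blast
  ultimately have "complex_of_real ((norm (T g))\<^sup>2) = complex_of_real ((norm (T x))\<^sup>2)"
    using g by (simp add: cinner_self)
  then have "norm (T g) = norm (T x)"
    by (simp only: of_real_eq_iff) (simp add: power2_eq_iff_nonneg)
  moreover have "norm (T h) \<le> norm (T x)" if "h \<in> G" for h
    using max[of h] that GM G(1) by (auto simp: orthonormal_def)
  ultimately show ?thesis
    using g by (intro bexI[of _ g]) auto
qed

text \<open>
  The second condition says that \<open>e\<close> is an eigenvector of \<open>T\<^sup>*T\<close>; it is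
  stated without the adjoint, whose existence is only derived from the basis obtained here.
\<close>

lemma eigenbasis_exists:
  obtains E where "orthonormal_basis E"
    "\<And>e x. e \<in> E \<Longrightarrow> cinner (T e) (T x) = complex_of_real ((norm (T e))\<^sup>2) * cinner e x"
proof -
  note T = absolutely_norm_attaining_bounded_clinear
  define eig where
    "eig e \<longleftrightarrow> (\<forall>x. cinner (T e) (T x) = complex_of_real ((norm (T e))\<^sup>2) * cinner e x)" for e
  define A where "A = {E. orthonormal E \<and> (\<forall>e\<in>E. eig e)}"
  have "\<exists>E\<in>A. \<forall>X\<in>A. E \<subseteq> X \<longrightarrow> X = E"
  proof (rule subset_Zorn')
    fix C assume C: "subset.chain A C"
    have "orthonormal (\<Union>C)"
      unfolding orthonormal_def
    proof (intro conjI ballI impI)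
      fix e f assume "e \<in> \<Union>C" "f \<in> \<Union>C" "e \<noteq> f"
      then obtain X Y where "X \<in> C" "Y \<in> C" "e \<in> X" "f \<in> Y"
        by blast
      moreover from this have "X \<subseteq> Y \<or> Y \<subseteq> X"
        using C by (auto simp: subset_chain_def)
      ultimately obtain Z where "Z \<in> C" "e \<in> Z" "f \<in> Z"
        by blast
      then show "cinner e f = 0"
        using C \<open>e \<noteq> f\<close> by (auto simp: subset_chain_def A_def orthonormal_def)
    qed (use C in \<open>auto simp: subset_chain_def A_def orthonormal_def\<close>)
    then show "\<Union>C \<in> A"
      using C by (auto simp: subset_chain_def A_def)
  qed
  then obtain E where E: "orthonormal E" "\<And>e. e \<in> E \<Longrightarrow> eig e"
    and maximal: "\<And>X. X \<in> A \<Longrightarrow> E \<subseteq> X \<Longrightarrow> X = E"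
    by (auto simp: A_def)
  have "orth_compl E = {0}"
  proof (rule ccontr)
    assume "orth_compl E \<noteq> {0}"
    then obtain x where x: "x \<in> orth_compl E" "norm x = 1"
      and max: "\<And>y. y \<in> orth_compl E \<Longrightarrow> norm (T y) \<le> norm (T x) * norm y"
      using absolutely_norm_attainingD[OF AN csubspace_orth_compl closed_orth_compl] by blast
    have orth: "cinner x e = 0" "cinner e x = 0" if "e \<in> E" for e
      using x that by (auto simp: orth_compl_def cinner_eq_0_commute)
    have "cinner (T x) (T y) = complex_of_real ((norm (T x))\<^sup>2) * cinner x y" for y
    proof -
      \<comment> \<open>The maximizer identity covers only vectors of the complement. The remaining
        part \<open>p\<close> of \<open>y\<close> is orthogonal to \<open>x\<close>, and its image
        is orthogonal to \<open>T x\<close> because the members of \<open>E\<close> are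
        eigenvectors, so \<open>p\<close> contributes nothing to either side.\<close>
      define p where "p = diag E (\<lambda>_. 1) y"
      have "cinner (T p) (T x) = 0"
      proof (rule has_sum_unique)
        show "((\<lambda>e. cinner y e * cinner (T e) (T x)) has_sum cinner (T p) (T x)) E"
          unfolding p_def by (rule bounded_clinear_proj_has_sum[OF E(1) T])
        show "((\<lambda>e. cinner y e * cinner (T e) (T x)) has_sum 0) E"
          using E(2) orth by (intro has_sum_0) (auto simp: eig_def)
      qed
      then have "cinner (T x) (T p) = 0"
        by (simp add: cinner_eq_0_commute)
      moreover have "cinner p x = 0"
      proof (rule has_sum_unique)
        show "((\<lambda>e. complex_of_real 1 * cinner y e * cinner e x) has_sum cinner p x) E"
          unfolding p_def by (rule diag_cinner_has_sum[OF E(1), where B = 1]) simp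
        show "((\<lambda>e. complex_of_real 1 * cinner y e * cinner e x) has_sum 0) E"
          using orth by (intro has_sum_0) auto
      qed
      then have "cinner x p = 0"
        by (simp add: cinner_eq_0_commute)
      moreover have "y - p \<in> orth_compl E"
        unfolding p_def by (rule diff_proj_in_orth_compl[OF E(1)])
      from norm_maximizer_cinner[OF T csubspace_orth_compl x max this]
      have "cinner (T x) (T (y - p)) = complex_of_real ((norm (T x))\<^sup>2) * cinner x (y - p)" .
      ultimately show ?thesis
        by (simp add: bounded_clinear_diff[OF T] cinner_diff_right)
    qed
    then have "insert x E \<in> A"
      using E x orth by (auto simp: A_def eig_def orthonormal_def)
    then have "x \<in> E"
      using maximal[of "insert x E"] by auto
    then have "cinner x x = 0"
      using orth by simp
    then show False
      using x(2) by simp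
  qed
  then have "orthonormal_basis E"
    using E(1) by (auto simp: orthonormal_basis_def orth_compl_def)
  then show ?thesis
    using that E(2) by (auto simp: eig_def)
qed


text \<open>
  If infinitely many eigenvalues were at least \<open>\<alpha>\<close> and infinitely many at most
  \<open>\<beta> < \<alpha>\<close>, then pairing them off gives orthonormal vectors \<open>g\<^sub>n\<close> with orthogonal
  images whose squared norms \<open>\<alpha>\<^sup>2 - (\<alpha>\<^sup>2 - \<beta>\<^sup>2)/(n+1)\<close> have no maximum.
\<close>

lemma eigenvalues_not_infinite_on_both_sides:
  assumes E: "orthonormal E"
    and eig: "\<And>e x. e \<in> E \<Longrightarrow> cinner (T e) (T x) = complex_of_real ((norm (T e))\<^sup>2) * cinner e x"
    and \<beta>: "0 \<le> \<beta>" "\<beta> < \<alpha>"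
    and P: "infinite {e\<in>E. \<alpha> \<le> norm (T e)}"
  shows "finite {e\<in>E. norm (T e) \<le> \<beta>}"
proof (rule ccontr)
  note T = absolutely_norm_attaining_bounded_clinear
  assume S: "infinite {e\<in>E. norm (T e) \<le> \<beta>}"
  obtain s :: "nat \<Rightarrow> 'a" where s: "inj s" "range s \<subseteq> {e\<in>E. norm (T e) \<le> \<beta>}"
    using infinite_countable_subset[OF S] by (elim exE conjE)
  obtain p :: "nat \<Rightarrow> 'a" where p: "inj p" "range p \<subseteq> {e\<in>E. \<alpha> \<le> norm (T e)}"
    using infinite_countable_subset[OF P] by (elim exE conjE)
  have sE: "s n \<in> E" and pE: "p n \<in> E" for n
    using s p by auto
  have ps: "p n \<noteq> s m" for n m
  proof
    assume "p n = s m"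
    moreover have "norm (T (s m)) \<le> \<beta>" "\<alpha> \<le> norm (T (p n))"
      using s p by auto
    ultimately show False using \<beta> by simp
  qed
  define a where "a n = (norm (T (p n)))\<^sup>2" for n
  define b where "b n = (norm (T (s n)))\<^sup>2" for n
  \<comment> \<open>The values increase strictly from \<beta>^2 at \<open>n = 0\<close> towards
    \<alpha>^2 without reaching it. Hence they lie between \<open>b n\<close> and
    \<open>a n\<close>, and \<open>t n\<close> is the weight that writes \<open>c n\<close> as a
    convex combination of the two.\<close>
  define c where "c n = \<alpha>\<^sup>2 - (\<alpha>\<^sup>2 - \<beta>\<^sup>2) / (real n + 1)" for n
  define t where "t n = (c n - b n) / (a n - b n)" for n
  have \<alpha>\<beta>: "\<beta>\<^sup>2 < \<alpha>\<^sup>2"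
    using \<beta> by (simp add: power_strict_mono)
  have ca: "c n \<le> a n" and bc: "b n \<le> c n" and ba: "b n < a n" for n
  proof -
    have "norm (T (s n)) \<le> \<beta>" "\<alpha> \<le> norm (T (p n))"
      using s p by auto
    then have "b n \<le> \<beta>\<^sup>2" "\<alpha>\<^sup>2 \<le> a n"
      using \<beta> by (auto simp: a_def b_def power_mono)
    moreover have "(\<alpha>\<^sup>2 - \<beta>\<^sup>2) / (real n + 1) \<le> \<alpha>\<^sup>2 - \<beta>\<^sup>2"
      using \<alpha>\<beta> by (simp add: divide_le_eq mult_le_cancel_left1)
    moreover have "0 \<le> (\<alpha>\<^sup>2 - \<beta>\<^sup>2) / (real n + 1)"
      using \<alpha>\<beta> by simp
    ultimately show "c n \<le> a n" "b n \<le> c n" "b n < a n"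
      using \<alpha>\<beta> unfolding c_def by linarith+
  qed
  have t: "0 \<le> t n" "t n \<le> 1" "t n * a n + (1 - t n) * b n = c n" for n
  proof -
    show "0 \<le> t n" "t n \<le> 1"
      using ca[of n] bc[of n] ba[of n] by (auto simp: t_def)
    have "t n * (a n - b n) = c n - b n"
      using ba[of n] by (simp add: t_def)
    then show "t n * a n + (1 - t n) * b n = c n"
      by (simp add: algebra_simps)
  qed
  \<comment> \<open>Square roots of the weights make \<open>g n\<close> a unit vector whose image
    has as squared norm the convex combination \<open>c n\<close>. Different indices involve
    disjoint pairs of basis vectors, so the images stay orthogonal.\<close>
  define g where "g n = sqrt (t n) *\<^sub>R p n + sqrt (1 - t n) *\<^sub>R s n" for n
  have pp: "cinner (p n) (p m) = (if n = m then 1 else 0)" for n m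
    using orthonormal_cinner[OF E pE pE] p(1) by (simp add: inj_eq)
  have ss: "cinner (s n) (s m) = (if n = m then 1 else 0)" for n m
    using orthonormal_cinner[OF E sE sE] s(1) by (simp add: inj_eq)
  have ps0: "cinner (p n) (s m) = 0" "cinner (s m) (p n) = 0" for n m
    using orthonormal_cinner[OF E pE sE] orthonormal_cinner[OF E sE pE] ps[of n m] by auto
  have sqrt_sq: "complex_of_real (sqrt r) * complex_of_real (sqrt r) = complex_of_real r"
    if "0 \<le> r" for r
    using that by (simp flip: of_real_mult)
  have gg: "cinner (g n) (g m) = (if n = m then 1 else 0)" for n m
    using t(1,2)[of m]
    by (simp add: g_def cinner_add_left cinner_add_right cinner_scaleR_left cinner_scaleR_right
      pp ss ps0 sqrt_sq)
  have TT: "cinner (T (g n)) (T (g m)) = (if n = m then complex_of_real (c n) else 0)" for n m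
  proof -
    have "cinner (T (g n)) (T (g m))
      = complex_of_real (sqrt (t n)) * complex_of_real (sqrt (t m)) * cinner (T (p n)) (T (p m))
        + complex_of_real (sqrt (1 - t n)) * complex_of_real (sqrt (1 - t m))
          * cinner (T (s n)) (T (s m))"
      by (simp add: g_def bounded_clinear_add[OF T] bounded_clinear_scaleR[OF T] cinner_add_left
        cinner_add_right cinner_scaleR_left cinner_scaleR_right eig[OF pE] eig[OF sE] ps0)
    also have "\<dots> = (if n = m then complex_of_real (t n * a n + (1 - t n) * b n) else 0)"
      using t(1,2)[of m] by (simp add: eig[OF pE] eig[OF sE] pp ss a_def b_def sqrt_sq)
    finally show ?thesis
      by (simp only: t(3))
  qed
  have norm_g: "norm (g n) = 1" for n
  proof -
    have "complex_of_real ((norm (g n))\<^sup>2) = 1"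
      using gg[of n n] by (simp add: cinner_self)
    then have "(norm (g n))\<^sup>2 = 1"
      by (simp only: of_real_eq_1_iff)
    then show ?thesis by (simp add: power2_eq_1_iff) (use norm_ge_zero[of "g n"] in linarith)
  qed
  have norm_Tg: "(norm (T (g n)))\<^sup>2 = c n" for n
  proof -
    have "complex_of_real ((norm (T (g n)))\<^sup>2) = complex_of_real (c n)"
      using TT[of n n] by (simp add: cinner_self)
    then show ?thesis by (simp only: of_real_eq_iff)
  qed
  have "orthonormal (range g)"
    using gg norm_g by (auto simp: orthonormal_def)
  moreover have "cinner (T u) (T v) = 0" if "u \<in> range g" "v \<in> range g" "u \<noteq> v" for u v
    using that TT by auto
  ultimately obtain n where n: "\<And>m. norm (T (g m)) \<le> norm (T (g n))"
    using orthogonal_images_norm_attains_max[of "range g"] by auto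
  have "c (Suc n) \<le> c n"
    using power_mono[OF n[of "Suc n"], of 2] by (simp add: norm_Tg)
  moreover have "(\<alpha>\<^sup>2 - \<beta>\<^sup>2) / (real (Suc n) + 1) < (\<alpha>\<^sup>2 - \<beta>\<^sup>2) / (real n + 1)"
    using \<alpha>\<beta> by (intro divide_strict_left_mono) auto
  ultimately show False
    unfolding c_def by linarith
qed

text \<open>The number \<alpha> is the infimum of the thresholds exceeded by only finitely many
  eigenvalues, which gives finiteness above \<alpha> + \<epsilon>. If eigenvalues below \<alpha>
  exist, there is a largest one; infinitely many lie above it, so the preceding lemma leaves only
  finitely many at or below it.\<close>

lemma eigenvalues_cluster:
  assumes E: "orthonormal E"
    and eig: "\<And>e x. e \<in> E \<Longrightarrow> cinner (T e) (T x) = complex_of_real ((norm (T e))\<^sup>2) * cinner e x"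
  obtains \<alpha> where "0 \<le> \<alpha>" "\<And>\<epsilon>. 0 < \<epsilon> \<Longrightarrow> finite {e\<in>E. \<alpha> + \<epsilon> < norm (T e)}"
    "finite {e\<in>E. norm (T e) < \<alpha>}"
proof (cases "finite E")
  case True
  \<comment> \<open>For finite \<open>E\<close> every real number is such a threshold and the
    infimum would be meaningless; 0 serves instead.\<close>
  then show ?thesis using that[of 0] by simp
next
  case False
  note T = absolutely_norm_attaining_bounded_clinear
  obtain B where B: "\<And>x. norm (T x) \<le> norm x * B"
    using bounded_linear.pos_bounded[OF bounded_clinear_linear[OF T]] by blast
  define A where "A = {a. finite {e\<in>E. a < norm (T e)}}"
  have "{e\<in>E. B < norm (T e)} = {}"
  proof -
    have "norm (T e) \<le> B" if "e \<in> E" for e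
      using B[of e] E that by (simp add: orthonormal_def)
    then show ?thesis by force
  qed
  then have "B \<in> A" by (simp add: A_def del: Collect_empty_eq)
  have lower: "0 \<le> a" if "a \<in> A" for a
  proof (rule ccontr)
    assume "\<not> 0 \<le> a"
    then have "{e\<in>E. a < norm (T e)} = E"
      by (auto intro: less_le_trans[OF _ norm_ge_zero])
    then show False using that False by (simp add: A_def)
  qed
  then have bdd: "bdd_below A" by (auto simp: bdd_below_def)
  define \<alpha> where "\<alpha> = Inf A"
  have "0 \<le> \<alpha>"
    unfolding \<alpha>_def using \<open>B \<in> A\<close> lower by (intro cInf_greatest) auto
  moreover have "finite {e\<in>E. \<alpha> + \<epsilon> < norm (T e)}" if "0 < \<epsilon>" for \<epsilon>
  proof -
    have "Inf A < \<alpha> + \<epsilon>" using that by (simp add: \<alpha>_def)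
    then obtain a where a: "a \<in> A" "a < \<alpha> + \<epsilon>"
      using cInf_lessD[of A] \<open>B \<in> A\<close> by blast
    have "{e\<in>E. \<alpha> + \<epsilon> < norm (T e)} \<subseteq> {e\<in>E. a < norm (T e)}"
      using a(2) by auto
    moreover have "finite {e\<in>E. a < norm (T e)}"
      using a(1) by (simp add: A_def)
    ultimately show ?thesis by (rule finite_subset)
  qed
  moreover have "finite {e\<in>E. norm (T e) < \<alpha>}"
  proof (cases "{e\<in>E. norm (T e) < \<alpha>} = {}")
    case True
    then show ?thesis by (simp only: finite.emptyI)
  next
    case nonempty: False
    have "orthonormal {e\<in>E. norm (T e) < \<alpha>}"
      using E by (simp add: orthonormal_def)
    moreover have "cinner (T e) (T f) = 0"
      if "e \<in> {e\<in>E. norm (T e) < \<alpha>}" "f \<in> {e\<in>E. norm (T e) < \<alpha>}" "e \<noteq> f" for e f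
      using that eig[of e f] E by (simp add: orthonormal_def)
    ultimately obtain g where g: "g \<in> {e\<in>E. norm (T e) < \<alpha>}"
      and gmax: "\<And>h. h \<in> {e\<in>E. norm (T e) < \<alpha>} \<Longrightarrow> norm (T h) \<le> norm (T g)"
      using orthogonal_images_norm_attains_max[OF _ nonempty] by blast
    \<comment> \<open>Being below the infimum, \<open>norm (T g)\<close> is exceeded infinitely
      often. By maximality of \<open>g\<close> all the larger eigenvalues are at least \<alpha>,
      which opens the gap that the preceding lemma needs.\<close>
    have "norm (T g) \<notin> A"
      using g cInf_lower[OF _ bdd, of "norm (T g)"] by (auto simp: \<alpha>_def)
    then have "infinite {e\<in>E. norm (T g) < norm (T e)}"
      by (simp add: A_def)
    moreover have "{e\<in>E. norm (T g) < norm (T e)} \<subseteq> {e\<in>E. \<alpha> \<le> norm (T e)}"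
      using gmax by force
    ultimately have "infinite {e\<in>E. \<alpha> \<le> norm (T e)}"
      using infinite_super by blast
    from eigenvalues_not_infinite_on_both_sides[OF E eig norm_ge_zero _ this, of "T g"]
    have "finite {e\<in>E. norm (T e) \<le> norm (T g)}"
      using g by simp
    moreover have "{e\<in>E. norm (T e) < \<alpha>} \<subseteq> {e\<in>E. norm (T e) \<le> norm (T g)}"
      using gmax by auto
    ultimately show ?thesis by (rule rev_finite_subset)
  qed
  ultimately show ?thesis using that by blast
qed

end

section \<open>Compact and finite rank diagonal operators\<close>

text \<open>A compact set approximating \<open>S\<close> has a finite net, which then serves for the
  closure of \<open>S\<close>. The three thirds of \<epsilon> pay for passing from the closure to
  \<open>S\<close>, from \<open>S\<close> to \<open>K\<close> and from \<open>K\<close> to the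
  net.\<close>

lemma compact_closureI:
  fixes S :: "'a::{real_normed_vector, complete_space} set"
  assumes "\<And>\<epsilon>. 0 < \<epsilon> \<Longrightarrow> \<exists>K. compact K \<and> (\<forall>x\<in>S. \<exists>y\<in>K. dist y x < \<epsilon>)"
  shows "compact (closure S)"
  unfolding compact_eq_totally_bounded
proof (intro conjI allI impI)
  show "complete (closure S)"
    by (simp add: complete_eq_closed)
  fix \<epsilon> :: real assume "0 < \<epsilon>"
  then obtain K where K: "compact K" "\<And>x. x \<in> S \<Longrightarrow> \<exists>y\<in>K. dist y x < \<epsilon> / 3"
    using assms[of "\<epsilon> / 3"] by auto
  obtain k where k: "finite k" "K \<subseteq> (\<Union>z\<in>k. ball z (\<epsilon> / 3))"
    using K(1) \<open>0 < \<epsilon>\<close> unfolding compact_eq_totally_bounded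
    by (meson divide_pos_pos zero_less_numeral)
  have "closure S \<subseteq> (\<Union>z\<in>k. ball z \<epsilon>)"
  proof
    fix x assume "x \<in> closure S"
    then obtain x' where x': "x' \<in> S" "dist x' x < \<epsilon> / 3"
      using \<open>0 < \<epsilon>\<close> unfolding closure_approachable by (meson divide_pos_pos zero_less_numeral)
    obtain y where y: "y \<in> K" "dist y x' < \<epsilon> / 3"
      using K(2)[OF x'(1)] by blast
    obtain z where z: "z \<in> k" "dist z y < \<epsilon> / 3"
      using k(2) y(1) by (auto simp: subset_eq)
    have "dist z x \<le> dist z y + dist y x' + dist x' x"
      using dist_triangle[of z x y] dist_triangle[of y x x'] by linarith
    then show "x \<in> (\<Union>z\<in>k. ball z \<epsilon>)"
      using x' y z by force
  qed
  with k(1) show "\<exists>k. finite k \<and> closure S \<subseteq> (\<Union>z\<in>k. ball z \<epsilon>)"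
    by blast
qed

text \<open>Each further vector adds the continuous image of a closed disc, and a sum of two compact
  sets is compact.\<close>

lemma compact_combinations:
  fixes F :: "'a::complex_inner set"
  assumes "finite F"
  shows "compact {\<Sum>e\<in>F. scaleC (c e) e | c. \<forall>e\<in>F. cmod (c e) \<le> B}"
  using assms
proof (induction F rule: finite_induct)
  case empty
  then show ?case by simp
next
  case (insert f F)
  let ?C = "\<lambda>F. {\<Sum>e\<in>F. scaleC (c e) e | c. \<forall>e\<in>F. cmod (c e) \<le> B}"
  have "compact ((\<lambda>z. scaleC z f) ` cball 0 B)"
  proof (rule compact_continuous_image[OF linear_continuous_on])
    show "bounded_linear (\<lambda>z. scaleC z f)"
      by (rule bounded_linear_intro[where K = "norm f"])
        (simp_all add: scaleC_add_left norm_scaleC scaleR_conv_of_real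
          flip: scaleC_scaleC scaleC_of_real)
  qed simp
  then have "compact {u + v | u v. u \<in> (\<lambda>z. scaleC z f) ` cball 0 B \<and> v \<in> ?C F}"
    using insert.IH by (rule compact_sums)
  also have "{u + v | u v. u \<in> (\<lambda>z. scaleC z f) ` cball 0 B \<and> v \<in> ?C F} = ?C (insert f F)"
  proof (intro subset_antisym subsetI)
    fix w assume "w \<in> {u + v | u v. u \<in> (\<lambda>z. scaleC z f) ` cball 0 B \<and> v \<in> ?C F}"
    then obtain z c where zc: "w = scaleC z f + (\<Sum>e\<in>F. scaleC (c e) e)" "cmod z \<le> B"
        "\<forall>e\<in>F. cmod (c e) \<le> B"
      by auto
    have "(\<Sum>e\<in>F. scaleC (c e) e) = (\<Sum>e\<in>F. scaleC ((c(f := z)) e) e)"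
      using insert.hyps by (intro sum.cong) auto
    then have "w = (\<Sum>e\<in>insert f F. scaleC ((c(f := z)) e) e)"
      using insert.hyps zc by simp
    moreover have "\<forall>e\<in>insert f F. cmod ((c(f := z)) e) \<le> B"
      using zc by auto
    ultimately show "w \<in> ?C (insert f F)"
      by blast
  next
    fix w assume "w \<in> ?C (insert f F)"
    then obtain c where c: "w = (\<Sum>e\<in>insert f F. scaleC (c e) e)"
        "\<forall>e\<in>insert f F. cmod (c e) \<le> B"
      by blast
    then have "w = scaleC (c f) f + (\<Sum>e\<in>F. scaleC (c e) e)"
      using insert.hyps by simp
    moreover have "c f \<in> cball 0 B"
      using c by simp
    ultimately show "w \<in> {u + v | u v. u \<in> (\<lambda>z. scaleC z f) ` cball 0 B \<and> v \<in> ?C F}"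
      using c(2) by blast
  qed
  finally show ?case .
qed

text \<open>The image under \<open>V\<close> of the compact closure is compact, hence closed, and so
  contains the closure of the image of the ball.\<close>

lemma compact_operator_compose:
  fixes R :: "'a::complex_inner \<Rightarrow> 'b::complex_inner" and V :: "'b \<Rightarrow> 'c::complex_inner"
  assumes V: "bounded_clinear V" and R: "compact_operator R"
  shows "compact_operator (V \<circ> R)"
  unfolding compact_operator_def
proof
  show "bounded_clinear (V \<circ> R)"
    using assms by (simp add: bounded_clinear_compose compact_operator_def)
  have comp: "compact (V ` closure (R ` cball 0 1))"
    using R by (intro compact_continuous_image linear_continuous_on bounded_clinear_linear[OF V])
      (simp add: compact_operator_def)
  moreover have "closure ((V \<circ> R) ` cball 0 1) \<subseteq> V ` closure (R ` cball 0 1)"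
    using closure_subset[of "R ` cball 0 1"]
    by (intro closure_minimal compact_imp_closed[OF comp]) auto
  ultimately show "compact (closure ((V \<circ> R) ` cball 0 1))"
    by (metis closed_Int_compact closed_closure inf.absorb_iff1)
qed

lemma csubspace_range:
  assumes "bounded_clinear f"
  shows "csubspace (range f)"
  unfolding complex_vector.subspace_def
proof (intro conjI ballI allI)
  show "0 \<in> range f"
    using bounded_clinear_zero[OF assms] by (intro image_eqI[where x = 0]) auto
qed (auto simp flip: bounded_clinear_add[OF assms] bounded_clinear_scaleC[OF assms])

lemma diag_finite:
  assumes "finite F" "F \<subseteq> E" "\<And>e. e \<in> E \<Longrightarrow> e \<notin> F \<Longrightarrow> d e = 0"
  shows "diag E d x = (\<Sum>e\<in>F. scaleC (complex_of_real (d e) * cinner x e) e)"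
proof -
  have "diag E d x = infsum (\<lambda>e. scaleC (complex_of_real (d e) * cinner x e) e) F"
    unfolding diag_def using assms by (intro infsum_cong_neutral) auto
  then show ?thesis
    using assms(1) by simp
qed

context
  fixes E :: "'a::chilbert_space set"
  assumes E: "orthonormal E"
begin

text \<open>Removing the finitely many entries larger than \<epsilon>/2 leaves a diagonal operator
  of norm at most \<epsilon>/2. The removed part sends the unit ball into a compact set of bounded
  combinations, so the image of the ball is approximated as \<open>compact_closureI\<close>
  asks.\<close>

lemma compact_operator_diag:
  assumes d: "\<And>e. e \<in> E \<Longrightarrow> \<bar>d e\<bar> \<le> B"
    and fin: "\<And>\<epsilon>. 0 < \<epsilon> \<Longrightarrow> finite {e\<in>E. \<epsilon> < \<bar>d e\<bar>}"
  shows "compact_operator (diag E d)"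
  unfolding compact_operator_def
proof (intro conjI compact_closureI)
  show "bounded_clinear (diag E d)"
    by (rule bounded_clinear_diag[OF E d])
  fix \<epsilon> :: real assume \<epsilon>: "0 < \<epsilon>"
  define F where "F = {e\<in>E. \<epsilon> / 2 < \<bar>d e\<bar>}"
  define d' where "d' e = (if e \<in> F then 0 else d e)" for e
  have F: "finite F" "F \<subseteq> E"
    using fin[of "\<epsilon> / 2"] \<epsilon> by (auto simp: F_def)
  have d': "\<bar>d' e\<bar> \<le> \<epsilon> / 2" if "e \<in> E" for e
    using that \<epsilon> by (auto simp: d'_def F_def)
  let ?K = "{\<Sum>e\<in>F. scaleC (c e) e | c. \<forall>e\<in>F. cmod (c e) \<le> B}"
  have "\<exists>y\<in>?K. dist y z < \<epsilon>" if z: "z \<in> diag E d ` cball 0 1" for z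
  proof -
    obtain x where x: "z = diag E d x" "norm x \<le> 1"
      using z by (auto simp: dist_norm)
    define y where "y = (\<Sum>e\<in>F. scaleC (complex_of_real (d e) * cinner x e) e)"
    have "cmod (complex_of_real (d e) * cinner x e) \<le> B" if "e \<in> F" for e
    proof -
      have "cmod (cinner x e) \<le> 1"
        using norm_cinner_le[of x e] x(2) that F(2) E by (auto simp: orthonormal_def)
      then have "\<bar>d e\<bar> * cmod (cinner x e) \<le> B * 1"
        using d that F(2) by (intro mult_mono) (auto intro: order_trans[OF abs_ge_zero])
      then show ?thesis by (simp add: norm_mult)
    qed
    then have "y \<in> ?K"
      unfolding y_def
      by (intro CollectI exI[of _ "\<lambda>e. complex_of_real (d e) * cinner x e"]) auto
    moreover have "dist y z < \<epsilon>"
    proof -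
      have "z = y + diag E d' x"
      proof (rule has_sum_unique)
        show "((\<lambda>e. scaleC (complex_of_real (d e) * cinner x e) e) has_sum z) E"
          unfolding x(1) by (rule diag_has_sum[OF E d])
        have "y = diag E (\<lambda>e. d e - d' e) x"
          unfolding y_def using F by (subst diag_finite[of F]) (auto simp: d'_def intro!: sum.cong)
        moreover have "((\<lambda>e. scaleC (complex_of_real (d e - d' e) * cinner x e) e)
            has_sum diag E (\<lambda>e. d e - d' e) x) E"
          by (rule diag_has_sum[OF E, where B = B])
            (use d in \<open>auto simp: d'_def intro: order_trans[OF abs_ge_zero]\<close>)
        ultimately have "((\<lambda>e. scaleC (complex_of_real (d e - d' e) * cinner x e) e
            + scaleC (complex_of_real (d' e) * cinner x e) e) has_sum y + diag E d' x) E"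
          by (intro has_sum_add diag_has_sum[OF E d']) auto
        moreover have "scaleC (complex_of_real (d e - d' e) * cinner x e) e
            + scaleC (complex_of_real (d' e) * cinner x e) e
            = scaleC (complex_of_real (d e) * cinner x e) e" for e
          by (simp add: distrib_right[symmetric] flip: scaleC_add_left of_real_add)
        ultimately show "((\<lambda>e. scaleC (complex_of_real (d e) * cinner x e) e)
            has_sum y + diag E d' x) E"
          by (simp only:)
      qed
      then have "dist y z = norm (diag E d' x)"
        by (simp add: dist_norm)
      also have "\<dots> \<le> \<epsilon> / 2 * norm x"
        by (rule norm_diag_le[OF E d']) (use \<epsilon> in auto)
      also have "\<dots> \<le> \<epsilon> / 2"
        using x(2) \<epsilon> by (simp add: mult_left_le)
      also have "\<dots> < \<epsilon>"
        using \<epsilon> by simp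
      finally show ?thesis .
    qed
    ultimately show ?thesis ..
  qed
  then show "\<exists>K. compact K \<and> (\<forall>z\<in>diag E d ` cball 0 1. \<exists>y\<in>K. dist y z < \<epsilon>)"
    using compact_combinations[OF F(1)] by blast
qed

text \<open>Only finitely many terms of the series survive, so the range lies in the span of
  finitely many \<open>V e\<close>. Equality holds because \<open>V e\<close> is the image of
  \<open>e\<close> divided by \<open>d e\<close>.\<close>

lemma finite_rank_compose_diag:
  fixes V :: "'a \<Rightarrow> 'b::complex_inner"
  assumes V: "bounded_clinear V" and d: "\<And>e. e \<in> E \<Longrightarrow> \<bar>d e\<bar> \<le> B"
    and fin: "finite {e\<in>E. d e \<noteq> 0}"
  shows "finite_rank (V \<circ> diag E d)"
  unfolding finite_rank_def
proof (intro conjI exI)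
  define F where "F = {e\<in>E. d e \<noteq> 0}"
  have bc: "bounded_clinear (V \<circ> diag E d)"
    by (intro bounded_clinear_compose V bounded_clinear_diag[OF E d])
  then show "bounded_clinear (V \<circ> diag E d)" .
  show "finite (V ` F)"
    using fin by (simp add: F_def)
  have sum: "diag E d x = (\<Sum>e\<in>F. scaleC (complex_of_real (d e) * cinner x e) e)" for x
    by (rule diag_finite) (use fin in \<open>auto simp: F_def\<close>)
  show "range (V \<circ> diag E d) = cspan (V ` F)"
  proof
    show "range (V \<circ> diag E d) \<subseteq> cspan (V ` F)"
      unfolding comp_def sum bounded_clinear_sum[OF V] bounded_clinear_scaleC[OF V]
      by (intro image_subsetI complex_vector.span_sum complex_vector.span_scale
        complex_vector.span_base imageI)
    have "V e \<in> range (V \<circ> diag E d)" if "e \<in> F" for e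
    proof -
      have "diag E d e = (\<Sum>f\<in>F. if f = e then d e *\<^sub>R e else 0)"
        unfolding sum using that
        by (intro sum.cong) (auto simp: F_def orthonormal_cinner[OF E] scaleC_of_real)
      also have "\<dots> = d e *\<^sub>R e"
        using that fin by (simp add: F_def)
      finally have "V e = (V \<circ> diag E d) ((1 / d e) *\<^sub>R e)"
        using that bounded_clinear_scaleR[OF bc, of "1 / d e" e]
        by (simp add: F_def bounded_clinear_scaleR[OF V])
      then show ?thesis by blast
    qed
    moreover have "csubspace (range (V \<circ> diag E d))"
      by (rule csubspace_range[OF bc])
    ultimately show "cspan (V ` F) \<subseteq> range (V \<circ> diag E d)"
      by (intro complex_vector.span_minimal) auto
  qed
qed

end

section \<open>The decomposition\<close>

theorem theorem4p1:
  fixes T V :: "'a::chilbert_space \<Rightarrow> 'b::chilbert_space"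
  assumes "absolutely_norm_attaining T"
    and "polar_decomposition T V"
  shows "\<exists>(K :: 'a \<Rightarrow> 'b) (F :: 'a \<Rightarrow> 'b) (\<alpha> :: real).
    compact_operator K \<and> finite_rank F \<and> \<alpha> \<ge> 0 \<and>
    T = (\<lambda>x. K x - F x + \<alpha> *\<^sub>R V x) \<and>
    cadjoint K \<circ> F = (\<lambda>x. 0) \<and> K \<circ> cadjoint F = (\<lambda>x. 0) \<and>
    operator_le (cadjoint F \<circ> F) (\<lambda>x. \<alpha>\<^sup>2 *\<^sub>R x)"
proof -
  have T: "bounded_clinear T"
    by (rule absolutely_norm_attaining_bounded_clinear[OF assms(1)])
  have V: "bounded_clinear V" and TV: "T = V \<circ> operator_abs T"
    and null: "\<And>x. T x = 0 \<Longrightarrow> V x = 0"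
    using assms(2) by (auto simp: polar_decomposition_def partial_isometry_def null_space_def)
  obtain E where E: "orthonormal_basis E"
    and eig: "\<And>e x. e \<in> E \<Longrightarrow>
      cinner (T e) (T x) = complex_of_real ((norm (T e))\<^sup>2) * cinner e x"
    by (rule eigenbasis_exists[OF assms(1)]) (rule that)
  note on = orthonormal_basis_orthonormal[OF E]
  obtain \<alpha> where \<alpha>: "0 \<le> \<alpha>" "\<And>\<epsilon>. 0 < \<epsilon> \<Longrightarrow> finite {e\<in>E. \<alpha> + \<epsilon> < norm (T e)}"
    "finite {e\<in>E. norm (T e) < \<alpha>}"
    by (rule eigenvalues_cluster[OF assms(1) on eig]) (simp, rule that)
  define l where "l e = norm (T e)" for e
  \<comment> \<open>The entries \<open>k\<close> and \<open>f\<close> are the positive and negative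
    parts of \<open>l - \<alpha>\<close>: their difference is \<open>l - \<alpha>\<close> and their
    product is 0.\<close>
  define k where "k e = max (l e - \<alpha>) 0" for e
  define f where "f e = max (\<alpha> - l e) 0" for e
  define p where "p e = (if l e = 0 then 0 else 1 :: real)" for e
  obtain B where B: "0 < B" "\<And>x. norm (T x) \<le> norm x * B"
    using bounded_linear.pos_bounded[OF bounded_clinear_linear[OF T]] by blast
  have l: "0 \<le> l e" "l e \<le> B" "\<bar>l e\<bar> \<le> B" "\<bar>(l e)\<^sup>2\<bar> \<le> B\<^sup>2" if "e \<in> E" for e
  proof -
    show "0 \<le> l e" "l e \<le> B"
      using B(2)[of e] on that by (auto simp: l_def orthonormal_def)
    then show "\<bar>l e\<bar> \<le> B" "\<bar>(l e)\<^sup>2\<bar> \<le> B\<^sup>2"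
      by (auto simp: power_mono)
  qed
  have k: "\<bar>k e\<bar> \<le> B" if "e \<in> E" for e
    using l[OF that] \<alpha>(1) by (auto simp: k_def)
  have f: "\<bar>f e\<bar> \<le> \<alpha>" if "e \<in> E" for e
    using l[OF that] \<alpha>(1) by (auto simp: f_def)
  have p: "\<bar>p e\<bar> \<le> 1" for e
    by (simp add: p_def)
  have pf: "\<bar>p e * f e\<bar> \<le> \<alpha>" if "e \<in> E" for e
    using f[OF that] \<alpha>(1) by (auto simp: p_def)
  have fpf: "\<bar>f e * (p e * f e)\<bar> \<le> \<alpha>\<^sup>2" if "e \<in> E" for e
    unfolding abs_mult[of "f e"] power2_eq_square
    using f[OF that] pf[OF that] \<alpha>(1) by (intro mult_mono) auto
  note bc_diag = bounded_clinear_diag[OF on]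

  \<comment> \<open>Diagonal form of the modulus\<close>
  obtain T' where T': "bounded_clinear T'" "\<forall>x y. cinner (T x) y = cinner x (T' y)"
    using adjoint_exists[OF E T] by (elim exE conjE)
  have T'T: "cadjoint T \<circ> T = diag E (\<lambda>e. (l e)\<^sup>2)"
  proof (rule bounded_clinear_eqI[OF E])
    have T'_eq: "cadjoint T = T'"
      by (intro cadjoint_eqI T'(2)[rule_format])
    show "bounded_clinear (cadjoint T \<circ> T)"
      unfolding T'_eq by (rule bounded_clinear_compose[OF T'(1) T])
    show "bounded_clinear (diag E (\<lambda>e. (l e)\<^sup>2))"
      by (rule bc_diag[OF l(4)])
    fix e assume e: "e \<in> E"
    have "T' (T e) = (l e)\<^sup>2 *\<^sub>R e"
    proof (rule orthonormal_basis_eqI[OF E])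
      fix g
      have "cinner (T' (T e)) g = cnj (cinner (T g) (T e))"
        unfolding T'(2)[rule_format] by (rule cinner_commute)
      also have "\<dots> = cinner (T e) (T g)"
        by (rule cinner_commute[symmetric])
      also have "\<dots> = cinner ((l e)\<^sup>2 *\<^sub>R e) g"
        unfolding eig[OF e] cinner_scaleR_left l_def ..
      finally show "cinner (T' (T e)) g = cinner ((l e)\<^sup>2 *\<^sub>R e) g" .
    qed
    then show "(cadjoint T \<circ> T) e = diag E (\<lambda>e. (l e)\<^sup>2) e"
      by (simp only: T'_eq comp_apply diag_basis[OF E l(4) e])
  qed
  have TVl: "T x = V (diag E l x)" for x
    by (subst TV) (simp only: comp_apply operator_abs_eq_diag[OF E l(1,2) T'T])
  have T_basis: "T e = l e *\<^sub>R V e" if "e \<in> E" for e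
    by (simp only: TVl diag_basis[OF E l(3) that] bounded_clinear_scaleR[OF V])

  \<comment> \<open>Diagonal form of the adjoint of \<open>V\<close> composed with
    \<open>V\<close>\<close>
  obtain W where W: "bounded_clinear W" "\<forall>x y. cinner (V x) y = cinner x (W y)"
    using adjoint_exists[OF E V] by (elim exE conjE)
  have WV: "W (V x) = diag E p x" for x
  proof -
    have "W \<circ> V = diag E p"
    proof (rule bounded_clinear_eqI[OF E bounded_clinear_compose[OF W(1) V] bc_diag[OF p]])
      fix e assume e: "e \<in> E"
      have "W (V e) = p e *\<^sub>R e"
      proof (cases "l e = 0")
        case True
        then have "V e = 0"
          by (intro null) (simp add: l_def)
        then show "W (V e) = p e *\<^sub>R e"
          using True by (simp add: p_def bounded_clinear_zero[OF W(1)])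
      next
        case False
        show "W (V e) = p e *\<^sub>R e"
        proof (rule orthonormal_basis_eqI[OF E])
          fix g assume g: "g \<in> E"
          have "cinner (W (V e)) g = cnj (cinner (V g) (V e))"
            unfolding W(2)[rule_format] by (rule cinner_commute)
          then have WVg: "cinner (W (V e)) g = cinner (V e) (V g)"
            by (simp only: cinner_commute[of "V e" "V g", symmetric])
          show "cinner (W (V e)) g = cinner (p e *\<^sub>R e) g"
          proof (cases "l g = 0")
            case True
            then have "V g = 0"
              by (intro null) (simp add: l_def)
            then show ?thesis
              using True False orthonormal_cinner[OF on e g]
              by (auto simp: WVg cinner_scaleR_left)
          next
            case g0: False
            \<comment> \<open>Substituting \<open>T e = l e *\<^sub>R V e\<close> into the
              eigenvector equation and cancelling nonzero eigenvalues gives the inner products of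
              the vectors \<open>V e\<close>.\<close>
            have "complex_of_real (l e) * (complex_of_real (l g) * cinner (V e) (V g))
                = complex_of_real (l e) * (complex_of_real (l e) * cinner e g)"
              using eig[OF e, of g] unfolding l_def[symmetric]
              by (simp only: T_basis[OF e] T_basis[OF g] cinner_scaleR_left cinner_scaleR_right
                power2_eq_square of_real_mult mult_ac)
            then have "complex_of_real (l g) * cinner (V e) (V g)
                = complex_of_real (l e) * cinner e g"
              using False by simp
            then show ?thesis
              using False g0 orthonormal_cinner[OF on e g]
              by (auto simp: WVg cinner_scaleR_left p_def split: if_splits)
          qed
        qed
      qed
      then show "(W \<circ> V) e = diag E p e"
        by (simp only: comp_apply diag_basis[OF E p e])
    qed
    then show ?thesis
      by (simp only: fun_eq_iff comp_apply)
  qed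

  have diag_zero: "diag E d x = 0" if "\<And>e. e \<in> E \<Longrightarrow> d e = 0" for d x
    using that by (simp add: diag_finite[of "{}"])
  \<comment> \<open>Real entries make the diagonal factor self-adjoint, so taking the adjoint only
    reverses the order and replaces \<open>V\<close> by \<open>W\<close>.\<close>
  have adj: "cadjoint (V \<circ> diag E d) = diag E d \<circ> W"
    if "\<And>e. e \<in> E \<Longrightarrow> \<bar>d e\<bar> \<le> C" for d C
    by (rule cadjoint_eqI)
      (simp only: comp_apply W(2)[rule_format] cinner_diag_commute[OF on that])
  have kf: "k e * f e = 0" for e
    by (simp add: k_def f_def max_def)

  \<comment> \<open>Verification of the required properties\<close>
  define K where "K = V \<circ> diag E k"
  define F where "F = V \<circ> diag E f"
  have "compact_operator K"
    unfolding K_def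
  proof (rule compact_operator_compose[OF V compact_operator_diag[OF on k]])
    fix \<epsilon> :: real assume "0 < \<epsilon>"
    then show "finite {e\<in>E. \<epsilon> < \<bar>k e\<bar>}"
      by (intro finite_subset[OF _ \<alpha>(2)]) (auto simp: k_def l_def max_def split: if_splits)
  qed
  moreover have "finite_rank F"
    unfolding F_def
  proof (rule finite_rank_compose_diag[OF on V f])
    show "finite {e\<in>E. f e \<noteq> 0}"
      by (rule finite_subset[OF _ \<alpha>(3)]) (auto simp: f_def l_def max_def split: if_splits)
  qed
  moreover have "T = (\<lambda>x. K x - F x + \<alpha> *\<^sub>R V x)"
  proof
    fix x
    have "diag E l x = diag E k x - diag E f x + \<alpha> *\<^sub>R x"
    proof (rule orthonormal_basis_eqI[OF E])
      fix e assume e: "e \<in> E"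
      have "complex_of_real (l e) = complex_of_real (k e - f e + \<alpha>)"
        by (simp add: k_def f_def max_def)
      then show "cinner (diag E l x) e = cinner (diag E k x - diag E f x + \<alpha> *\<^sub>R x) e"
        by (simp only: cinner_add_left cinner_diff_left cinner_scaleR_left diag_coeff[OF on l(3) e]
          diag_coeff[OF on k e] diag_coeff[OF on f e])
          (simp add: algebra_simps)
    qed
    then show "T x = K x - F x + \<alpha> *\<^sub>R V x"
      by (simp only: TVl K_def F_def comp_apply bounded_clinear_add[OF V] bounded_clinear_diff[OF V]
        bounded_clinear_scaleR[OF V])
  qed
  moreover have "cadjoint K \<circ> F = (\<lambda>x. 0)"
  proof
    fix x
    \<comment> \<open>The inner factor \<open>W \<circ> V\<close> is the diagonal operator of
      \<open>p\<close>, so the whole product is diagonal with entries containing the factor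
      \<open>k e * f e\<close>.\<close>
    have "(cadjoint K \<circ> F) x = diag E k (diag E p (diag E f x))"
      by (simp only: K_def F_def adj[OF k] comp_apply WV)
    also have "\<dots> = diag E (\<lambda>e. k e * (p e * f e)) x"
      by (simp only: diag_diag[OF E p f] diag_diag[OF E k pf])
    also have "\<dots> = 0"
      using kf by (intro diag_zero) auto
    finally show "(cadjoint K \<circ> F) x = 0" .
  qed
  moreover have "K \<circ> cadjoint F = (\<lambda>x. 0)"
  proof
    fix y
    \<comment> \<open>In this order the two diagonal factors are adjacent, between \<open>V\<close>
      and \<open>W\<close>, and annihilate each other.\<close>
    have "(K \<circ> cadjoint F) y = V (diag E (\<lambda>e. k e * f e) (W y))"
      by (simp only: K_def F_def adj[OF f] comp_apply diag_diag[OF E k f])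
    also have "\<dots> = 0"
      using kf by (simp add: diag_zero bounded_clinear_zero[OF V])
    finally show "(K \<circ> cadjoint F) y = 0" .
  qed
  moreover have "operator_le (cadjoint F \<circ> F) (\<lambda>x. \<alpha>\<^sup>2 *\<^sub>R x)"
  proof -
    \<comment> \<open>Both sides of the operator inequality are diagonal, so it reduces to one
      between entries. It holds because \<open>l e\<close> is nonnegative, whence \<open>f e\<close>
      is at most \<alpha>, and \<open>p e\<close> is 0 or 1.\<close>
    have FF: "cadjoint F \<circ> F = diag E (\<lambda>e. f e * (p e * f e))"
      by (rule ext) (simp only: F_def adj[OF f] comp_apply WV diag_diag[OF E p f]
        diag_diag[OF E f pf])
    have scale: "(\<lambda>x. \<alpha>\<^sup>2 *\<^sub>R x) = diag E (\<lambda>_. \<alpha>\<^sup>2)"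
    proof (rule ext, rule orthonormal_basis_eqI[OF E])
      fix x e assume "e \<in> E"
      then show "cinner (\<alpha>\<^sup>2 *\<^sub>R x) e = cinner (diag E (\<lambda>_. \<alpha>\<^sup>2) x) e"
        by (simp add: diag_coeff[OF on, where B = "\<alpha>\<^sup>2"] cinner_scaleR_left)
    qed
    have diff: "\<bar>\<alpha>\<^sup>2 - f e * (p e * f e)\<bar> \<le> 2 * \<alpha>\<^sup>2" "0 \<le> \<alpha>\<^sup>2 - f e * (p e * f e)" if "e \<in> E" for e
      using fpf[OF that] by auto
    have sub: "(\<lambda>x. \<alpha>\<^sup>2 *\<^sub>R x - diag E (\<lambda>e. f e * (p e * f e)) x)
        = diag E (\<lambda>e. \<alpha>\<^sup>2 - f e * (p e * f e))"
    proof (rule ext, rule orthonormal_basis_eqI[OF E])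
      fix x e assume e: "e \<in> E"
      show "cinner (\<alpha>\<^sup>2 *\<^sub>R x - diag E (\<lambda>e. f e * (p e * f e)) x) e
          = cinner (diag E (\<lambda>e. \<alpha>\<^sup>2 - f e * (p e * f e)) x) e"
        by (simp only: cinner_diff_left cinner_scaleR_left diag_coeff[OF on fpf e]
          diag_coeff[OF on diff(1) e] of_real_diff left_diff_distrib)
    qed
    show ?thesis
      unfolding operator_le_def FF sub
      by (intro conjI self_adjoint_diag[OF on fpf] positive_operator_diag[OF on diff])
        (simp_all add: scale self_adjoint_diag[OF on, where B = "\<alpha>\<^sup>2"])
  qed
  ultimately show ?thesis
    using \<alpha>(1) by (intro exI[of _ K] exI[of _ F] exI[of _ \<alpha>] conjI)
qed

end
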